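(* Let $n\ge1$, $t>0$ and $\mathbf{G}_n(t)=\{(x_1,\dots,x_n):0\le x_1\le 1+t,\ 0\le x_i\le(1+t)x_{i-1}\ (2\le i\le n)\}$. For a labeled forest $F$ on $\{1,\dots,n+1\}$ define for each label $k$ the coordinate $c(k,F;t)$: if the node with label $k$ is the root of its component and has NFS position $l$, then $c(k,F;t)=t\,x_l$ (with $x_0:=1$); otherwise $c(k,F;t)=x_i/(1+t)^{j}-x_l$, where $i$ is its NFS position, $j$ the number of cane paths of $F$ starting at it, and $l$ the NFS position of the root of its component. Let $$\mathbf{S}_F(t)=\{(x_1,\dots,x_n):0\le c(1,F;t)\le c(2,F;t)\le\dots\le c(n+1,F;t)=t\}.$$ Then $\mathbf{S}_F(t)$ is a simplex and $$n!\operatorname{vol}\mathbf{S}_F(t)=\sum_{G:\ \Phi(G)=F}t^{|E(G)|}=t^{|E(F)|}(1+t)^{\alpha(F)},$$ the sum over labeled graphs $G$ on $\{1,\dots,n+1\}$. Furthermore, the simplices $\mathbf{S}_F(t)$, $F$ ranging over labeled forests on $\{1,\dots,n+1\}$, form a triangulation of $\mathbf{G}_n(t)$; in particular $n!\operatorname{vol}\mathbf{G}_n(t)=\sum_G t^{|E(G)|}=(1+t)^{\binom{n+1}{2}}$, the sum over all labeled graphs on $\{1,\dots,n+1\}$.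
   Context: Labeled forest conventions: each component of a labeled forest on $\{1,\dots,n+1\}$ is rooted at its node of largest label, children are ordered left to right by increasing label, components left to right by decreasing largest label. NFS positions in a forest on $n+1$ nodes: components processed left to right; when a component is begun its root gets the next unused position (starting from $0$; so each root gets the number of nodes in components to its left); within a component the root is initially active, the children of the active node receive the next consecutive positions from right to left and then the leftmost child becomes active; if the active node has no children, the most recently positioned node not yet active becomes active. Cane path: a path $v_0,\dots,v_k$ ($k\ge 2$) whose first $k-1$ steps go from a node to its parent and whose last step goes from $v_{k-1}$ to a child of $v_{k-1}$ to the right of $v_{k-2}$; $\alpha(F)$ is the number of cane paths in $F$. NFS of a labeled graph $G$ on $\{1,\dots,n+1\}$: components are processed in order of decreasing maximal label; in a component, its node of maximal label is visited first and made active; at each step the unvisited neighbours of the active node are visited in decreasing order of label, each joined to the active node by a search edge, and the one of smallest label becomes active; if the active node has no unvisited neighbours, the most recently visited node not yet active becomes active. $\Phi(G)$ is the labeled spanning forest of search edges. A triangulation of a polytope $P\subset\mathbb{R}^n$ is a set of $n$-simplices with union $P$ and pairwise disjoint interiors. *)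

theory Defs
  imports "HOL-Analysis.Analysis" "HOL-Library.While_Combinator"
begin

section \<open>Labeled graphs\<close>

text \<open>A labeled graph on \<open>{1..n+1}\<close> is a simple graph, given by its set of edges, each edge
  being a two-element set of labels. So a spanning subgraph is a set of edges, and
  \<open>|E(G)|\<close> is \<open>card G\<close>.\<close>

type_synonym edges = "nat set set"

definition labeled_graphs :: "nat \<Rightarrow> edges set" where
  "labeled_graphs n = Pow {{u, v} | u v. u \<in> {1..n+1} \<and> v \<in> {1..n+1} \<and> u \<noteq> v}"

definition adjacent :: "edges \<Rightarrow> nat \<Rightarrow> nat \<Rightarrow> bool" where
  "adjacent G u v \<longleftrightarrow> {u, v} \<in> G"

definition graph_path :: "edges \<Rightarrow> nat list \<Rightarrow> bool" where
  "graph_path G p \<longleftrightarrow> p \<noteq> [] \<and> distinct p \<and> successively (adjacent G) p"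

definition graph_cycle :: "edges \<Rightarrow> nat list \<Rightarrow> bool" where
  "graph_cycle G p \<longleftrightarrow> graph_path G p \<and> length p \<ge> 3 \<and> adjacent G (last p) (hd p)"

definition labeled_forests :: "nat \<Rightarrow> edges set" where
  "labeled_forests n = {F \<in> labeled_graphs n. \<not> (\<exists>p. graph_cycle F p)}"

definition component :: "edges \<Rightarrow> nat \<Rightarrow> nat set" where
  "component G v = {u. (adjacent G)\<^sup>*\<^sup>* v u}"

definition root_of :: "edges \<Rightarrow> nat \<Rightarrow> nat" where
  "root_of G v = Max (component G v)"

text \<open>Components are represented by their largest labels, listed in decreasing order.\<close>

definition roots :: "nat \<Rightarrow> edges \<Rightarrow> nat list" where
  "roots n G = rev (sorted_list_of_set (root_of G ` {1..n+1}))"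


section \<open>Neighbors-first search\<close>

text \<open>A state consists of the list of visited nodes in order of visit, the list of visited nodes
  that have not yet been active (most recently visited first; the node at its head is
  the one to become active next), and the set of search edges. \<open>new a vis\<close> lists the nodes to be
  visited from the active node \<open>a\<close>, in order of visit. The last of them, if any, becomes the
  head of the pending list, so it is the next active node.\<close>

type_synonym search_state = "nat list \<times> nat list \<times> edges"

definition nfs_step :: "(nat \<Rightarrow> nat list \<Rightarrow> nat list) \<Rightarrow> search_state \<Rightarrow> search_state" where
  "nfs_step new = (\<lambda>(vis, pend, S).
     let a = hd pend; ws = new a vis
     in (vis @ ws, rev ws @ tl pend, S \<union> {{a, w} | w. w \<in> set ws}))"

definition nfs_component :: "(nat \<Rightarrow> nat list \<Rightarrow> nat list) \<Rightarrow> nat \<Rightarrow> search_state" where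
  "nfs_component new r =
     while (\<lambda>(vis, pend, S). pend \<noteq> []) (nfs_step new) ([r], [r], {})"

definition unvisited_neighbours :: "edges \<Rightarrow> nat \<Rightarrow> nat list \<Rightarrow> nat list" where
  "unvisited_neighbours G a vis = rev (sorted_list_of_set ({w. adjacent G a w} - set vis))"

definition search_forest :: "nat \<Rightarrow> edges \<Rightarrow> edges" ("\<Phi>") where
  "\<Phi> n G = (\<Union>r \<in> set (roots n G). snd (snd (nfs_component (unvisited_neighbours G) r)))"


section \<open>Labeled forests as rooted plane forests\<close>

text \<open>\<open>parent_of F v u\<close>: the node \<open>u\<close> is the parent of \<open>v\<close>, i.e. the next node on the path from
  \<open>v\<close> to the root of its component.\<close>

definition parent_of :: "edges \<Rightarrow> nat \<Rightarrow> nat \<Rightarrow> bool" where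
  "parent_of F v u \<longleftrightarrow> (\<exists>q. graph_path F (v # u # q) \<and> last (u # q) = root_of F v)"

text \<open>Siblings are ordered left to right by increasing label, so right to left is by decreasing
  label.\<close>

definition children_right_to_left :: "edges \<Rightarrow> nat \<Rightarrow> nat list" where
  "children_right_to_left F u = rev (sorted_list_of_set {v. parent_of F v u})"

definition nfs_order :: "nat \<Rightarrow> edges \<Rightarrow> nat list" where
  "nfs_order n F =
     concat (map (\<lambda>r. fst (nfs_component (\<lambda>a vis. children_right_to_left F a) r)) (roots n F))"

definition nfs_position :: "nat \<Rightarrow> edges \<Rightarrow> nat \<Rightarrow> nat" where
  "nfs_position n F v = (THE i. i < length (nfs_order n F) \<and> nfs_order n F ! i = v)"

text \<open>The nodes \<open>p ! 0, \<dots>, p ! k\<close> form the path; \<open>p ! k\<close> lies to the right of its sibling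
  \<open>p ! (k - 2)\<close> iff its label is larger.\<close>

definition cane_path :: "edges \<Rightarrow> nat list \<Rightarrow> bool" where
  "cane_path F p \<longleftrightarrow> graph_path F p \<and>
     (\<exists>k\<ge>2. length p = k + 1 \<and>
        (\<forall>i<k-1. parent_of F (p ! i) (p ! (i+1))) \<and>
        parent_of F (p ! k) (p ! (k-1)) \<and> p ! (k-2) < p ! k)"

definition cane_paths_from :: "edges \<Rightarrow> nat \<Rightarrow> nat" where
  "cane_paths_from F v = card {p. cane_path F p \<and> hd p = v}"

definition cane_paths :: "edges \<Rightarrow> nat" ("\<alpha>") where
  "\<alpha> F = card {p. cane_path F p}"


section \<open>Triangulations\<close>

text \<open>Unlike the library constant \<open>triangulation\<close>, this names the triangulated polytope, asks for
  simplices of full dimension, and does not require them to meet along common faces.\<close>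

definition triangulation_of :: "'a::euclidean_space set set \<Rightarrow> 'a set \<Rightarrow> bool" where
  "triangulation_of T P \<longleftrightarrow> polytope P \<and> (\<forall>S\<in>T. int DIM('a) simplex S) \<and> \<Union>T = P \<and>
     pairwise (\<lambda>S S'. interior S \<inter> interior S' = {}) T"


section \<open>The polytope and the simplices\<close>

text \<open>The space of dimension \<open>n\<close> is \<open>real ^ 'n\<close>, with a bijection \<open>e\<close> from \<open>{1..n}\<close> to the index
  type \<open>'n\<close> numbering the coordinates; \<open>coord e x i\<close> is \<open>x\<^sub>i\<close>, including the convention that
  the coordinate numbered 0 is 1.\<close>

definition coord :: "(nat \<Rightarrow> 'n::finite) \<Rightarrow> real ^ 'n \<Rightarrow> nat \<Rightarrow> real" where
  "coord e x i = (if i = 0 then 1 else x $ e i)"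

definition gayley_polytope :: "nat \<Rightarrow> (nat \<Rightarrow> 'n::finite) \<Rightarrow> real \<Rightarrow> (real ^ 'n) set" where
  "gayley_polytope n e t =
     {x. 0 \<le> coord e x 1 \<and> coord e x 1 \<le> 1 + t \<and>
         (\<forall>i\<in>{2..n}. 0 \<le> coord e x i \<and> coord e x i \<le> (1 + t) * coord e x (i-1))}"

definition node_coord ::
    "nat \<Rightarrow> (nat \<Rightarrow> 'n::finite) \<Rightarrow> edges \<Rightarrow> real \<Rightarrow> real ^ 'n \<Rightarrow> nat \<Rightarrow> real" where
  "node_coord n e F t x k =
     (let l = nfs_position n F (root_of F k) in
      if k = root_of F k then t * coord e x l
      else coord e x (nfs_position n F k) / (1 + t) ^ cane_paths_from F k - coord e x l)"

definition forest_simplex :: "nat \<Rightarrow> (nat \<Rightarrow> 'n::finite) \<Rightarrow> real \<Rightarrow> edges \<Rightarrow> (real ^ 'n) set" where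
  "forest_simplex n e t F =
     {x. 0 \<le> node_coord n e F t x 1 \<and>
         (\<forall>k\<in>{1..n}. node_coord n e F t x k \<le> node_coord n e F t x (k+1)) \<and>
         node_coord n e F t x (n+1) = t}"

end

theory Submission
  imports Defs
begin

text \<open>
  In the search of a forest, the nodes waiting on the stack when a node is pushed are exactly the
  ends of the cane paths that start at it. Hence \<open>\<Phi> n G = F\<close> iff \<open>G\<close> arises from \<open>F\<close> by
  adding edges that join the two ends of cane paths of \<open>F\<close>, which gives the sum over the fiber.

  Let \<open>j\<close> be the number of cane paths from the node at position \<open>p\<close>, and \<open>l\<close> the position of its
  root. A point of the simplex of \<open>F\<close> satisfies
  \<open>x\<^sub>l \<le> x\<^sub>p / (1 + t) ^ j \<le> (1 + t) x\<^sub>l\<close> if the node is not a root, and \<open>x\<^sub>p \<le> x\<^sub>m\<close> if it is a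
  root and \<open>m\<close> is the position of the preceding root. As \<open>j\<close> is a stack size, it increases by at
  most one per position, and between nonroots it increases only from a node to its sibling, so the
  simplex lies in the polytope. An interior point determines the roots, the numbers \<open>j\<close> and, by
  sorting the node coordinates, the labels; these data let one replay the search and recover \<open>F\<close>,
  so the simplices have disjoint interiors. The node coordinates are a triangular affine function
  of \<open>x\<close>, which yields the volumes. They add up to the volume of the polytope, so the simplices
  cover it.
\<close>

section \<open>Volumes of simplices\<close>

text \<open>Dividing by \<open>(1 + t) ^ j\<close> is what separates the forests: it confines the
  ratio of a nonroot coordinate to its root coordinate to the interval from
  \<open>(1 + t) ^ j\<close> to \<open>(1 + t) ^ (j + 1)\<close>, and these intervals overlap only
  at their ends, so an interior point knows \<open>j\<close>. Replaying from the numbers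
  \<open>j\<close> works because siblings pushed over a stack of size \<open>s\<close> receive the
  sizes \<open>s\<close>, \<open>s + 1\<close>, and so on, whereas the next batch starts with a size
  at most that of the last sibling. So the sizes alone show where a batch ends. To find a simplex
  containing a given point of the polytope, one would have to invert the construction. The volumes
  avoid this. The fibers of \<open>\<Phi>\<close> partition the labeled graphs, so the simplex
  volumes, times \<open>fact n\<close>, add up to the sum of \<open>t ^ card G\<close> over all
  graphs, a power of \<open>1 + t\<close>. The polytope is itself a simplex with this volume, and a
  closed subset of full measure in a convex body is the whole body. The search loop is replaced by a
  list of its events. The same list records the search of a graph and the traversal of its search
  forest, which ties \<open>\<Phi>\<close> to the NFS positions.\<close>

lemma det_triangular_rank:
  fixes A :: "real^'n^'n" and f :: "'n \<Rightarrow> nat"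
  assumes A: "\<And>i j. i \<noteq> j \<Longrightarrow> f i \<le> f j \<Longrightarrow> A $ i $ j = 0"
  shows "det A = (\<Prod>i\<in>UNIV. A $ i $ i)"
proof -
  \<comment> \<open>The index type carries no order; \<open>f\<close> stands in for it. A
    permutation other than \<open>id\<close> that lowered \<open>f\<close> wherever it moves a point
    would lower the sum of \<open>f\<close>, which permuting leaves unchanged. So some factor of the
    product vanishes.\<close>
  have zero: "of_int (sign p) * (\<Prod>i\<in>UNIV. A $ i $ p i) = 0"
    if p: "p permutes UNIV" "p \<noteq> id" for p
  proof -
    have "\<exists>i. p i \<noteq> i \<and> f i \<le> f (p i)"
    proof (rule ccontr)
      assume "\<not> ?thesis"
      then have *: "p i = i \<or> f (p i) < f i" for i
        by (meson not_le)
      obtain i where "p i \<noteq> i"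
        using p(2) by (auto simp: fun_eq_iff)
      with * have "f (p i) < f i" by blast
      moreover have "f (p i) \<le> f i" for i
        using * [of i] by auto
      ultimately have "(\<Sum>i\<in>UNIV. f (p i)) < (\<Sum>i\<in>UNIV. f i)"
        by (intro sum_strict_mono_ex1) auto
      moreover have "(\<Sum>i\<in>UNIV. f (p i)) = (\<Sum>i\<in>UNIV. f i)"
        using sum.permute [OF p(1), of f] by (simp add: o_def)
      ultimately show False by simp
    qed
    then obtain i where "p i \<noteq> i" "f i \<le> f (p i)" by blast
    then have "A $ i $ p i = 0"
      using A [of i "p i"] by auto
    then have "(\<Prod>i\<in>UNIV. A $ i $ p i) = 0"
      by (intro prod_zero) auto
    then show ?thesis by simp
  qed
  have "det A = (\<Sum>p\<in>{id}. of_int (sign p) * (\<Prod>i\<in>UNIV. A $ i $ p i))"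
    unfolding det_def
    by (rule sum.mono_neutral_right) (auto simp: permutes_id zero)
  then show ?thesis by (simp add: sign_id)
qed

lemma measure_shear_cbox:
  fixes a b :: "real^'n"
  assumes "i \<noteq> j"
  shows "measure lebesgue ((\<lambda>x. \<chi> k. if k = i then x $ i + x $ j else x $ k) ` cbox a b)
    = measure lebesgue (cbox a b)" (is "measure _ (?f ` _) = _")
proof (cases "cbox a b = {}")
  case False
  have add: "?f (x + y) = ?f x + ?f y" for x y
    by (simp add: vec_eq_iff)
  \<comment> \<open>Translating by \<open>c\<close> makes the \<open>j\<close>-th lower bound 0,
    because \<open>measure_shear_interval\<close> asks for that bound to be nonnegative.\<close>
  define c where "c = axis j (a $ j)"
  have box: "cbox a b = (+) c ` cbox (a - c) (b - c)"
    using cbox_translation [of c "a - c" "b - c"] by simp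
  have "?f ` cbox a b = (+) (?f c) ` ?f ` cbox (a - c) (b - c)"
    unfolding box image_image add ..
  then have "measure lebesgue (?f ` cbox a b) = measure lebesgue (?f ` cbox (a - c) (b - c))"
    by (simp only: measure_translation)
  also have "\<dots> = measure lebesgue (cbox (a - c) (b - c))"
    by (rule measure_shear_interval [OF assms]) (use False box in \<open>auto simp: c_def\<close>)
  also have "\<dots> = measure lebesgue (cbox a b)"
    unfolding box by (simp only: measure_translation)
  finally show ?thesis .
qed simp

text \<open>The library states this for well-ordered index types only.\<close>

lemma measure_linear_image_finite:
  fixes f :: "real^'n \<Rightarrow> real^'n"
  assumes "linear f" "S \<in> lmeasurable"
  shows "f ` S \<in> lmeasurable \<and> measure lebesgue (f ` S) = \<bar>det (matrix f)\<bar> * measure lebesgue S"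
proof -
  have "\<forall>S\<in>lmeasurable. f ` S \<in> lmeasurable \<and>
      measure lebesgue (f ` S) = \<bar>det (matrix f)\<bar> * measure lebesgue S"
  \<comment> \<open>The five cases are compositions, maps with a coordinate that is constantly 0,
    diagonal maps, swaps of two coordinates, and shears.\<close>
  proof ((rule induct_linear_elementary [OF \<open>linear f\<close>]; intro ballI), goal_cases)
    case (1 f g S)
    then show ?case
      unfolding image_comp [symmetric] matrix_compose [OF 1(2,1)] det_mul abs_mult by simp
  next
    case (2 f i S)
    then have "\<not> surj f"
      by (metis one_neq_zero surjD vec_component)
    then have "\<not> inj f"
      using "2" linear_injective_imp_surjective by blast
    moreover have "negligible (f ` S)"
      using "2" \<open>\<not> inj f\<close> negligible_linear_singular_image by blast
    ultimately show ?case
      using det_nz_iff_inj [OF \<open>linear f\<close>] by (simp add: negligible_iff_measure)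
  next
    case (3 c S)
    moreover have "det (matrix (\<lambda>x::real^'n. \<chi> i. c i * x $ i)) = (\<Prod>i\<in>UNIV. c i)"
      by (subst det_diagonal) (auto simp: matrix_def axis_def)
    ultimately show ?case
      by (simp add: measurable_stretch measure_stretch)
  next
    case (4 m n S)
    let ?\<tau> = "Transposition.transpose m n"
    let ?h = "\<lambda>x::real^'n. \<chi> i. x $ ?\<tau> i"
    have lin: "linear ?h"
      by (rule linearI) (simp_all add: vec_eq_iff)
    have inv: "?h (?h x) = x" for x
      by (simp add: vec_eq_iff)
    \<comment> \<open>Only the absolute value of the determinant matters. A swap is its own inverse,
      so its determinant squares to 1.\<close>
    have "?h \<circ> ?h = id"
      using inv by (auto simp: fun_eq_iff)
    then have "matrix ?h ** matrix ?h = mat 1"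
      using matrix_compose [OF lin lin] by (simp add: matrix_id_mat_1)
    then have "det (matrix ?h) * det (matrix ?h) = 1"
      by (metis det_I det_mul)
    then have det: "\<bar>det (matrix ?h)\<bar> = 1"
      by (metis abs_mult_self_eq abs_1 abs_square_eq_1 power2_eq_square)
    have box: "measure lebesgue (?h ` cbox a b) = measure lebesgue (cbox a b)" for a b
    proof (cases "cbox a b = {}")
      case False
      have eq: "?h ` cbox a b = cbox (?h a) (?h b)"
      proof
        show "?h ` cbox a b \<subseteq> cbox (?h a) (?h b)"
          by (auto simp: mem_box_cart)
        show "cbox (?h a) (?h b) \<subseteq> ?h ` cbox a b"
        proof
          fix x assume "x \<in> cbox (?h a) (?h b)"
          then have "a $ ?\<tau> (?\<tau> i) \<le> x $ ?\<tau> i \<and> x $ ?\<tau> i \<le> b $ ?\<tau> (?\<tau> i)" for i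
            by (simp only: mem_box_cart vec_lambda_beta)
          then have "?h x \<in> cbox a b"
            by (simp add: mem_box_cart)
          then show "x \<in> ?h ` cbox a b"
            using inv [of x] by (metis image_eqI)
        qed
      qed
      have "(\<Prod>i\<in>UNIV. ?h b $ i - ?h a $ i) = (\<Prod>i\<in>UNIV. b $ i - a $ i)"
        using prod.permute [OF permutes_swap_id, of m UNIV n "\<lambda>i. b $ i - a $ i"] by (simp add: o_def)
      moreover have "cbox (?h a) (?h b) \<noteq> {}"
        using False eq by blast
      ultimately show ?thesis
        using False by (simp add: eq content_cbox_cart)
    qed simp
    from measure_linear_sufficient [OF lin \<open>S \<in> lmeasurable\<close>, of 1] box det show ?case by simp
  next
    case (5 m n S)
    let ?h = "\<lambda>x::real^'n. \<chi> i. if i = m then x $ m + x $ n else x $ i"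
    have lin: "linear ?h"
      by (rule linearI) (auto simp: algebra_simps vec_eq_iff)
    have "det (matrix ?h) = (\<Prod>i\<in>UNIV. matrix ?h $ i $ i)"
      by (rule det_triangular_rank [where f = "\<lambda>i. if i = m then 1 else 0"])
         (auto simp: matrix_def axis_def)
    also have "\<dots> = 1"
      using \<open>m \<noteq> n\<close> by (intro prod.neutral) (auto simp: matrix_def axis_def)
    finally show ?case
      using measure_linear_sufficient [OF lin \<open>S \<in> lmeasurable\<close>, of 1] measure_shear_cbox [OF \<open>m \<noteq> n\<close>]
      by simp
  qed
  then show ?thesis using assms(2) by blast
qed

text \<open>\<open>S\<close> is the image of the standard simplex under the inverse affine map,
  which carries vertices and interior along. For the volume, \<open>L\<close> maps \<open>S\<close>
  back onto a translate of the standard simplex, so the determinant ends up in the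
  denominator.\<close>

lemma affine_preimage_std_simplex:
  fixes L :: "real^'n \<Rightarrow> real^'n" and b :: "real^'n"
  assumes lin: "linear L" and det: "det (matrix L) \<noteq> 0"
  defines "S \<equiv> {x. L x + b \<in> convex hull (insert 0 Basis)}"
  shows "int CARD('n) simplex S"
    and "fact CARD('n) * measure lebesgue S = 1 / \<bar>det (matrix L)\<bar>"
    and "interior S = {x. L x + b \<in> interior (convex hull (insert 0 Basis))}"
proof -
  let ?\<Delta> = "convex hull (insert 0 Basis) :: (real^'n) set"
  have "inj L"
    using det det_nz_iff_inj [OF lin] by blast
  then obtain M where M: "linear M" "\<And>x. M (L x) = x" "\<And>x. L (M x) = x"
    using linear_injective_isomorphism [OF lin] by blast
  have injM: "inj M"
    using M(3) by (metis injI)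
  have img: "{x. L x + b \<in> T} = (+) (- M b) ` M ` T" for T
  proof (intro subset_antisym subsetI)
    fix x assume "x \<in> {x. L x + b \<in> T}"
    moreover have "x = - M b + M (L x + b)"
      by (simp add: linear_add [OF M(1)] M(2))
    ultimately show "x \<in> (+) (- M b) ` M ` T" by blast
  next
    fix x assume "x \<in> (+) (- M b) ` M ` T"
    then obtain y where "y \<in> T" "x = - M b + M y" by blast
    then show "x \<in> {x. L x + b \<in> T}"
      by (simp add: linear_diff [OF lin] M(3))
  qed
  have ind: "independent (M ` Basis)"
    using linear_independent_injective_image [OF M(1) independent_Basis] injM by (simp add: inj_on_subset)
  have "\<not> affine_dependent (insert 0 (M ` Basis))"
    using ind dependent_zero by (subst affine_dependent_iff_dependent) auto
  then have 1: "\<not> affine_dependent ((+) (- M b) ` M ` insert 0 Basis)"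
    by (metis affine_dependent_translation_eq image_insert linear_0 [OF M(1)])
  have S_hull: "S = convex hull ((+) (- M b) ` M ` insert 0 Basis)"
    unfolding S_def img by (simp only: convex_hull_translation convex_hull_linear_image [OF M(1)])
  have "card ((+) (- M b) ` M ` insert 0 Basis) = card (insert 0 Basis :: (real^'n) set)"
    using injM by (metis card_image inj_on_subset subset_UNIV inj_on_add)
  also have "\<dots> = CARD('n) + 1"
    by (simp add: card_insert_if)
  finally show simp: "int CARD('n) simplex S"
    unfolding simplex_def using 1 S_hull by (intro exI [of _ "(+) (- M b) ` M ` insert 0 Basis"]) simp
  have "(+) b ` L ` S = ?\<Delta>"
  proof -
    have "L x + b \<in> ?\<Delta> \<longleftrightarrow> x \<in> S" for x by (simp add: S_def)
    moreover have "y = b + L (M (y - b))" for y by (simp add: M(3))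
    ultimately show ?thesis
      by (auto simp: S_def image_iff add.commute) (metis M(3) diff_add_cancel)
  qed
  then have "measure lebesgue ?\<Delta> = measure lebesgue (L ` S)"
    by (metis measure_translation)
  also have "\<dots> = \<bar>det (matrix L)\<bar> * measure lebesgue S"
    using measure_linear_image_finite [OF lin, of S] simp
    by (simp add: compact_imp_bounded lmeasurable_compact polytope_imp_compact simplex_imp_polytope)
  finally have "\<bar>det (matrix L)\<bar> * measure lebesgue S = 1 / fact CARD('n)"
    using content_std_simplex [where 'a = "real^'n"]
    by (simp add: compact_imp_closed finite_imp_compact_convex_hull)
  then show "fact CARD('n) * measure lebesgue S = 1 / \<bar>det (matrix L)\<bar>"
    using det by (simp add: field_simps)
  have "interior S = (+) (- M b) ` M ` interior ?\<Delta>"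
    unfolding S_def img
    by (simp only: interior_translation interior_injective_linear_image [OF M(1) injM])
  then show "interior S = {x. L x + b \<in> interior ?\<Delta>}"
    unfolding img .
qed

text \<open>The forest simplices and the polytope are both given by chains of inequalities between
  affine functions. Consecutive differences, scaled by \<open>1 / t\<close>, turn such a chain into
  the standard simplex.\<close>

lemma ordered_simplex:
  fixes L :: "real^'n \<Rightarrow> real^'n" and b :: "real^'n" and e :: "nat \<Rightarrow> 'n"
  assumes lin: "linear L" and det: "det (matrix L) \<noteq> 0"
    and n: "n \<ge> 1" and e: "bij_betw e {1..n} UNIV" and t: "t > 0"
  defines "y \<equiv> \<lambda>x k. (L x + b) $ e k"
  defines "S \<equiv> {x. 0 \<le> y x 1 \<and> (\<forall>k\<in>{1..<n}. y x k \<le> y x (k+1)) \<and> y x n \<le> t}"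
  shows "int n simplex S"
    and "fact n * measure lebesgue S = t ^ n / \<bar>det (matrix L)\<bar>"
    and "interior S = {x. 0 < y x 1 \<and> (\<forall>k\<in>{1..<n}. y x k < y x (k+1)) \<and> y x n < t}"
proof -
  define g where "g = inv_into {1..n} e"
  have g: "bij_betw g UNIV {1..n}"
    unfolding g_def by (rule bij_betw_inv_into [OF e])
  have ge: "g (e k) = k" if "k \<in> {1..n}" for k
    unfolding g_def using e that by (simp add: bij_betw_def)
  have eg: "e (g i) = i" for i
    unfolding g_def using e by (simp add: bij_betw_inv_into_right)
  have gr: "g i \<in> {1..n}" for i
    using g by (auto simp: bij_betw_def)
  have n_card: "CARD('n) = n"
    using bij_betw_same_card [OF e] by simp
  \<comment> \<open>\<open>q\<close> puts a 0 in front of the coordinates, so that the first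
    difference taken by \<open>Q\<close> is the first coordinate itself.\<close>
  define q where "q = (\<lambda>(v::real^'n) k. if k = 0 then 0 else v $ e k)"
  define Q where "Q = (\<lambda>v::real^'n. \<chi> i. (q v (g i) - q v (g i - 1)) / t)"
  have linQ: "linear Q"
    by (rule linearI) (auto simp: Q_def q_def vec_eq_iff algebra_simps add_divide_distrib diff_divide_distrib)
  have "det (matrix Q) = (\<Prod>i\<in>UNIV. matrix Q $ i $ i)"
  proof (rule det_triangular_rank [where f = g])
    fix i j assume ij: "i \<noteq> j" "g i \<le> g j"
    moreover from this have "g i \<noteq> g j" by (metis eg)
    moreover have "g (e (g i - 1)) = g i - 1" if "g i \<noteq> 1"
      using gr [of i] that by (intro ge) auto
    moreover have "i = e 1" if "g i = 1"
      using eg [of i] that by simp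
    ultimately show "matrix Q $ i $ j = 0"
      using gr [of i] by (cases "g i = 1") (auto simp: matrix_def Q_def q_def axis_def eg)
  qed
  also have "\<dots> = (\<Prod>i\<in>(UNIV::'n set). 1 / t)"
  proof (rule prod.cong)
    fix i
    have "e (g i - Suc 0) \<noteq> i" if "g i \<noteq> 1"
    proof -
      have "g (e (g i - 1)) = g i - 1"
        using gr [of i] that by (intro ge) auto
      then show ?thesis using gr [of i] by auto
    qed
    then show "matrix Q $ i $ i = 1 / t"
      using gr [of i] by (auto simp: matrix_def Q_def q_def axis_def eg)
  qed simp
  finally have detQ: "det (matrix Q) = (1 / t) ^ n"
    using n_card by simp
  define L' where "L' = Q \<circ> L"
  have linL': "linear L'"
    unfolding L'_def using lin linQ linear_compose by blast
  have detL': "det (matrix L') = (1 / t) ^ n * det (matrix L)"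
    unfolding L'_def matrix_compose [OF lin linQ] det_mul detQ ..
  then have det0: "det (matrix L') \<noteq> 0"
    using det t by simp
  define z where "z = (\<lambda>x. L' x + Q b)"
  have z: "z x $ e k = (y x k - (if k = 1 then 0 else y x (k - 1))) / t" if "k \<in> {1..n}" for x k
    using that ge [OF that]
    by (simp add: z_def L'_def linear_add [OF linQ, symmetric] Q_def q_def y_def add_divide_distrib diff_divide_distrib)
  \<comment> \<open>The differences telescope: the sum condition of the standard simplex becomes the
    upper end of the chain.\<close>
  have sumz: "(\<Sum>i\<in>UNIV. z x $ i) = y x n / t" for x
  proof -
    have part: "(\<Sum>k\<in>{1..m}. z x $ e k) = y x m / t" if "1 \<le> m" "m \<le> n" for m
      using that
    proof (induction m)
      case (Suc m)
      then show ?case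
      proof (cases "m = 0")
        case False
        then have "(\<Sum>k\<in>{1..m}. z x $ e k) = y x m / t"
          using Suc by simp
        then show ?thesis
          using Suc.prems False z [of "Suc m" x] by (simp add: diff_divide_distrib)
      next
        case True
        then show ?thesis using z [of 1 x] n by simp
      qed
    qed simp
    have "(\<Sum>i\<in>UNIV. z x $ i) = (\<Sum>k\<in>{1..n}. z x $ e k)"
      using sum.reindex_bij_betw [OF e, of "\<lambda>i. z x $ i"] by simp
    then show ?thesis using part [of n] n by simp
  qed
  have all: "(\<forall>i. P (z x $ i)) \<longleftrightarrow> (\<forall>k\<in>{1..n}. P (z x $ e k))" for P x
    by (metis eg gr)
  have split: "{1..n} = insert 1 (Suc ` {1..<n})"
    using n by auto
  have std: "x \<in> convex hull (insert 0 Basis) \<longleftrightarrow> (\<forall>i. 0 \<le> x $ i) \<and> (\<Sum>i\<in>UNIV. x $ i) \<le> 1" 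
    "x \<in> interior (convex hull (insert 0 Basis)) \<longleftrightarrow> (\<forall>i. 0 < x $ i) \<and> (\<Sum>i\<in>UNIV. x $ i) < 1" for x :: "real^'n"
  proof -
    have B: "Basis = range (\<lambda>i::'n. axis i (1::real))"
      by (auto simp: Basis_vec_def)
    have "inj (\<lambda>i::'n. axis i (1::real))"
      by (auto simp: inj_on_def axis_eq_axis)
    then have "(\<Sum>i\<in>Basis. x \<bullet> i) = (\<Sum>i\<in>UNIV. x $ i)"
      unfolding B by (subst sum.reindex) (auto simp: inner_axis)
    then show "x \<in> convex hull (insert 0 Basis) \<longleftrightarrow> (\<forall>i. 0 \<le> x $ i) \<and> (\<Sum>i\<in>UNIV. x $ i) \<le> 1" 
      "x \<in> interior (convex hull (insert 0 Basis)) \<longleftrightarrow> (\<forall>i. 0 < x $ i) \<and> (\<Sum>i\<in>UNIV. x $ i) < 1"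
      unfolding interior_std_simplex unfolding std_simplex by (auto simp: B inner_axis)
  qed
  have zx: "L' x + Q b = z x" for x
    by (simp add: z_def)
  have z1: "z x $ e 1 = y x 1 / t" for x
    using z [of 1 x] n by simp
  have zSuc: "z x $ e (Suc k) = (y x (Suc k) - y x k) / t" if "k \<in> {1..<n}" for x k
    using z [of "Suc k" x] that by simp
  have nonneg: "(\<forall>i. 0 \<le> z x $ i) \<longleftrightarrow> 0 \<le> y x 1 \<and> (\<forall>k\<in>{1..<n}. y x k \<le> y x (k+1))" for x
    unfolding all split ball_simps using z1 zSuc t by (simp add: zero_le_divide_iff)
  have pos: "(\<forall>i. 0 < z x $ i) \<longleftrightarrow> 0 < y x 1 \<and> (\<forall>k\<in>{1..<n}. y x k < y x (k+1))" for x
    unfolding all split ball_simps using z1 zSuc t by (simp add: zero_less_divide_iff)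
  have S_eq: "S = {x. L' x + Q b \<in> convex hull (insert 0 Basis)}"
    unfolding zx std sumz nonneg S_def using t by (auto simp: divide_simps)
  have I_eq: "{x. 0 < y x 1 \<and> (\<forall>k\<in>{1..<n}. y x k < y x (k+1)) \<and> y x n < t}
      = {x. L' x + Q b \<in> interior (convex hull (insert 0 Basis))}"
    unfolding zx std sumz pos using t by (auto simp: divide_simps)
  note * = affine_preimage_std_simplex [OF linL' det0, of "Q b", folded S_eq]
  show "int n simplex S"
    using * n_card by simp
  show "fact n * measure lebesgue S = t ^ n / \<bar>det (matrix L)\<bar>"
    using * n_card t unfolding detL' by (simp add: abs_mult field_simps power_abs)
  show "interior S = {x. 0 < y x 1 \<and> (\<forall>k\<in>{1..<n}. y x k < y x (k+1)) \<and> y x n < t}"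
    unfolding I_eq by (rule *)
qed

section \<open>Runs of the search\<close>

text \<open>An event \<open>(a, ws, ps)\<close> consists of the active node, the nodes visited from it, and the
  nodes that wait on the stack below it.\<close>

type_synonym event = "nat \<times> nat list \<times> nat list"

text \<open>A derivation exists only for a terminating search, so facts about the
  \<open>while\<close> loop become rule inductions. Searching a graph and traversing a plane forest
  differ only in \<open>new\<close>.\<close>

inductive nfs_run :: "(nat \<Rightarrow> nat list \<Rightarrow> nat list) \<Rightarrow> nat list \<Rightarrow> nat list \<Rightarrow> event list \<Rightarrow> bool"
  for new where
  Nil: "nfs_run new vis [] []"
| Cons: "nfs_run new (vis @ ws) (rev ws @ ps) ev \<Longrightarrow> ws = new a vis
    \<Longrightarrow> nfs_run new vis (a # ps) ((a, ws, ps) # ev)"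

definition discovered :: "event list \<Rightarrow> nat list" where
  "discovered ev = concat (map (\<lambda>(a, ws, ps). ws) ev)"

definition discovers :: "event list \<Rightarrow> nat \<Rightarrow> nat \<Rightarrow> bool" where
  "discovers ev a w \<longleftrightarrow> (\<exists>ws ps. (a, ws, ps) \<in> set ev \<and> w \<in> set ws)"

lemma discovered_simps [simp]:
  "discovered [] = []"
  "discovered ((a, ws, ps) # ev) = ws @ discovered ev"
  by (simp_all add: discovered_def)

lemma discovers_simps [simp]:
  "\<not> discovers [] a w"
  "discovers ((b, ws, ps) # ev) a w \<longleftrightarrow> a = b \<and> w \<in> set ws \<or> discovers ev a w"
  by (auto simp: discovers_def)

lemma set_discovered: "w \<in> set (discovered ev) \<longleftrightarrow> (\<exists>a. discovers ev a w)"
  by (force simp: discovered_def discovers_def)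

lemma nfs_run_while:
  "nfs_run new vis pend ev \<Longrightarrow>
    while (\<lambda>(vis, pend, S). pend \<noteq> []) (nfs_step new) (vis, pend, S)
      = (vis @ discovered ev, [], S \<union> {{a, w} | a w. discovers ev a w})"
proof (induction arbitrary: S rule: nfs_run.induct)
  case (Nil vis)
  then show ?case
    by (subst while_unfold) simp
next
  case (Cons vis ws ps ev a)
  then show ?case
    by (subst while_unfold) (auto simp: nfs_step_def Let_def)
qed

lemma nfs_component_eq:
  "nfs_run new [r] [r] ev \<Longrightarrow>
    nfs_component new r = (r # discovered ev, [], {{a, w} | a w. discovers ev a w})"
  unfolding nfs_component_def by (simp add: nfs_run_while)

lemma nfs_run_exists:
  assumes "finite K" "\<And>a vis. set (new a vis) \<subseteq> K - set vis" "\<And>a vis. distinct (new a vis)"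
  shows "\<exists>ev. nfs_run new vis pend ev"
\<comment> \<open>A newly visited node gives up weight 2 and takes weight 1 on the stack, and the
  active node leaves the stack, so each step lowers this measure.\<close>
proof (induction "2 * card (K - set vis) + length pend" arbitrary: vis pend rule: less_induct)
  case less
  show ?case
  proof (cases pend)
    case (Cons a ps)
    define ws where "ws = new a vis"
    have ws: "set ws \<subseteq> K - set vis" "distinct ws"
      using assms by (auto simp: ws_def)
    have "K - set (vis @ ws) = K - set vis - set ws"
      by auto
    then have "card (K - set (vis @ ws)) = card (K - set vis) - length ws"
      using ws by (simp add: card_Diff_subset distinct_card)
    moreover have "length ws \<le> card (K - set vis)"
      using ws assms(1) by (metis card_mono distinct_card finite_Diff)
    ultimately have "2 * card (K - set (vis @ ws)) + length (rev ws @ ps)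
        < 2 * card (K - set vis) + length pend"
      using Cons by simp
    then obtain ev where "nfs_run new (vis @ ws) (rev ws @ ps) ev"
      using less by blast
    then show ?thesis
      unfolding Cons ws_def by (blast intro: nfs_run.Cons)
  qed (blast intro: nfs_run.Nil)
qed

text \<open>Used to reread the search of a graph as the traversal of its search forest, where the
  children of a node do not depend on \<open>vis\<close>.\<close>

lemma nfs_run_cong:
  "nfs_run new vis pend ev \<Longrightarrow> (\<And>a ws ps vis. (a, ws, ps) \<in> set ev \<Longrightarrow> new' a vis = ws)
    \<Longrightarrow> nfs_run new' vis pend ev"
proof (induction rule: nfs_run.induct)
  case (Cons vis ws ps ev a)
  have "ws = new' a vis"
    using Cons.prems [of a ws ps vis] by simp
  moreover have "nfs_run new' (vis @ ws) (rev ws @ ps) ev"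
    using Cons.prems by (intro Cons.IH) (metis list.set_intros(2))
  ultimately
  show ?case
    by (blast intro: nfs_run.Cons)
qed (rule nfs_run.Nil)

section \<open>Invariants of a run\<close>

lemma nfs_run_event:
  "nfs_run new vis pend ev \<Longrightarrow> (a, ws, ps) \<in> set ev \<Longrightarrow> \<exists>vis. ws = new a vis"
  by (induction rule: nfs_run.induct) auto

text \<open>This part of the invariant mentions neither \<open>new\<close> nor \<open>vis\<close>,
  so it survives joining the runs of different components. It makes time of activation increase from
  a node to its children and to the nodes waiting below it.\<close>

fun wf_events :: "event list \<Rightarrow> bool" where
  "wf_events [] \<longleftrightarrow> True"
| "wf_events ((a, ws, ps) # ev) \<longleftrightarrow>
     a \<notin> set (map fst ev) \<and> distinct (ws @ ps) \<and> set (ws @ ps) \<subseteq> set (map fst ev) \<and>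
     set ws \<inter> set (discovered ev) = {} \<and> wf_events ev"

lemma nfs_run_wf:
  assumes "nfs_run new vis pend ev"
    and "\<And>a vis. distinct (new a vis)" "\<And>a vis. set (new a vis) \<inter> set vis = {}"
    and "distinct pend" "set pend \<subseteq> set vis"
  shows "wf_events ev \<and> set (map fst ev) = set pend \<union> set (discovered ev) \<and>
    set (discovered ev) \<inter> set vis = {}"
  using assms(1,4,5)
proof (induction rule: nfs_run.induct)
  case (Cons vis ws ps ev a)
  have ws: "distinct ws" "set ws \<inter> set vis = {}"
    using Cons.hyps assms by auto
  have "distinct (rev ws @ ps)" "set (rev ws @ ps) \<subseteq> set (vis @ ws)"
    using Cons.prems ws by auto
  note IH = Cons.IH [OF this]
  show ?case using IH ws Cons.prems by auto
qed simp

lemma nfs_run_closed: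
  assumes "nfs_run (unvisited_neighbours G) vis pend ev"
    and "\<And>a. finite {w. adjacent G a w}"
    and "a \<in> set (map fst ev)" "adjacent G a w"
  shows "w \<in> set vis \<or> w \<in> set (discovered ev)"
  using assms(1,3)
proof (induction rule: nfs_run.induct)
  case (Cons vis ws ps ev b)
  have "set ws = {w. adjacent G b w} - set vis"
    using Cons.hyps assms(2) by (simp add: unvisited_neighbours_def)
  then show ?case
    using Cons assms(4) by auto
qed simp

text \<open>An edge is seen when its first end becomes active. At that moment the other end is either new
  or still waiting on the stack.\<close>

lemma nfs_run_edge:
  assumes "nfs_run (unvisited_neighbours G) vis pend ev"
    and "\<And>a. finite {w. adjacent G a w}"
    and "distinct pend" "set pend \<subseteq> set vis"
    and "u \<in> set (map fst ev)" "v \<in> set (map fst ev)" "adjacent G u v" "u \<noteq> v"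
  shows "\<exists>a ws ps w. (a, ws, ps) \<in> set ev \<and> {u, v} = {a, w} \<and> w \<in> set ws \<union> set ps"
  using assms(1,3-6)
proof (induction rule: nfs_run.induct)
  case (Cons vis ws ps ev a)
  have run: "nfs_run (unvisited_neighbours G) vis (a # ps) ((a, ws, ps) # ev)"
    using Cons.hyps nfs_run.Cons by blast
  have new: "distinct (unvisited_neighbours G b vis)"
    "set (unvisited_neighbours G b vis) = {w. adjacent G b w} - set vis" for b vis
    using assms(2) by (auto simp: unvisited_neighbours_def)
  have stack: "distinct (rev ws @ ps)" "set (rev ws @ ps) \<subseteq> set (vis @ ws)"
    using Cons.prems(1,2) unfolding Cons.hyps(2) by (auto simp: new)
  have wf: "set (map fst ev) = set (rev ws @ ps) \<union> set (discovered ev)"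
      "set (discovered ev) \<inter> set (vis @ ws) = {}"
    using nfs_run_wf [OF Cons.hyps(1)] new stack by auto
  \<comment> \<open>A node that becomes active later is on the new stack or is discovered later. The
    latter is impossible for a neighbour of \<open>a\<close>: being unvisited, it would have been
    pushed now.\<close>
  have other: "w \<in> set ws \<union> set ps" if "adjacent G a w" "w \<in> set (map fst ev)" for w
    using that wf new Cons.hyps(2) by auto
  have sym: "adjacent G v u"
    using assms(7) by (simp add: adjacent_def insert_commute)
  consider "u = a" "v \<in> set (map fst ev)" | "v = a" "u \<in> set (map fst ev)"
    | "u \<in> set (map fst ev)" "v \<in> set (map fst ev)"
    using Cons.prems assms(8) by auto
  then show ?case
  proof cases
    case 1
    then show ?thesis using other assms(7) by (metis list.set_intros(1))
  next
    case 2
    then show ?thesis using other sym by (metis insert_commute list.set_intros(1))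
  next
    case 3
    then show ?thesis
      using Cons.IH [OF stack 3] by (metis list.set_intros(2))
  qed
qed simp

text \<open>\<open>cn\<close> and \<open>en\<close> stand for the number of cane paths from a node and the set of their ends:
  they describe the stack below the node.\<close>

lemma nfs_run_stack:
  assumes "nfs_run new vis pend ev"
    and "\<And>ys b zs. pend = ys @ b # zs \<Longrightarrow> cn b = length zs \<and> en b = set zs"
    and "\<And>a ws ps i. (a, ws, ps) \<in> set ev \<Longrightarrow> i < length ws \<Longrightarrow>
      cn (ws ! i) = i + cn a \<and> en (ws ! i) = set (take i ws) \<union> en a"
    and "(a, ws, ps) \<in> set ev"
  shows "cn a = length ps \<and> en a = set ps"
  using assms
proof (induction rule: nfs_run.induct)
  case (Cons vis us qs ev b)
  have b: "cn b = length qs \<and> en b = set qs"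
    using Cons.prems(1) [of "[]"] by simp
  have "cn c = length zs \<and> en c = set zs" if eq: "rev us @ qs = ys @ c # zs" for ys c zs
  proof -
    \<comment> \<open>An entry from the old stack keeps what lies below it. A new entry is the one
      with index \<open>length vs\<close> in \<open>us\<close>; below it lie the nodes pushed just
      before it and then the old stack.\<close>
    consider (old) vs where "qs = vs @ c # zs" | (new) vs where "rev us = ys @ c # vs" "zs = vs @ qs"
      using eq by (fastforce simp: append_eq_append_conv2 append_eq_Cons_conv)
    then show ?thesis
    proof cases
      case old
      then show ?thesis using Cons.prems(1) [of "b # vs" c zs] by simp
    next
      case new
      then have us: "us = rev vs @ c # rev ys"
        by (metis append.assoc append_Cons append_Nil rev.simps(2) rev_append rev_rev_ident)
      have "cn (us ! length vs) = length vs + cn b \<and> en (us ! length vs) = set (take (length vs) us) \<union> en b"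
        by (rule Cons.prems(2)) (auto simp: us)
      then show ?thesis
        using new b by (auto simp: us nth_append)
    qed
  qed
  note stack = this
  show ?case
  proof (cases "(a, ws, ps) = (b, us, qs)")
    case False
    then have "(a, ws, ps) \<in> set ev"
      using Cons.prems(3) by auto
    moreover have "cn (us' ! i) = i + cn a' \<and> en (us' ! i) = set (take i us') \<union> en a'"
      if "(a', us', qs') \<in> set ev" "i < length us'" for a' us' qs' i
      using Cons.prems(2) [of a' us' qs' i] that by simp
    ultimately show ?thesis
      using Cons.IH stack by blast
  qed (use b in simp)
qed simp

section \<open>Stack sizes along the search\<close>

text \<open>Each visited node is paired with the size of the stack at the moment it is pushed.\<close>

definition annotated :: "event list \<Rightarrow> (nat \<times> nat) list" where
  "annotated ev = concat (map (\<lambda>(a, ws, ps). zip ws [length ps..<length ps + length ws]) ev)"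

lemma annotated_simps [simp]:
  "annotated [] = []"
  "annotated ((a, ws, ps) # ev) = zip ws [length ps..<length ps + length ws] @ annotated ev"
  by (simp_all add: annotated_def)

lemma annotated_eq_map:
  assumes "\<And>a ws ps i. (a, ws, ps) \<in> set ev \<Longrightarrow> i < length ws \<Longrightarrow> cn (ws ! i) = length ps + i"
  shows "annotated ev = map (\<lambda>v. (v, cn v)) (discovered ev)"
  using assms
proof (induction ev)
  case (Cons e ev)
  obtain a ws ps where e: "e = (a, ws, ps)"
    by (cases e)
  have "zip ws [length ps..<length ps + length ws] = map (\<lambda>v. (v, cn v)) ws"
    using Cons.prems [of a ws ps] e by (intro nth_equalityI) auto
  then show ?case
    using Cons by (auto simp: e)
qed simp

text \<open>The head of \<open>pend\<close> is popped before anything is pushed, and steps that find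
  no new node only shrink the stack.\<close>

lemma annotated_hd:
  "nfs_run new vis pend ev \<Longrightarrow> annotated ev = (v, j) # xs \<Longrightarrow> j < length pend"
proof (induction rule: nfs_run.induct)
  case (Cons vis ws ps ev a)
  show ?case
  proof (cases ws)
    case Nil
    then show ?thesis using Cons.IH Cons.prems by simp
  next
    case ws: (Cons x ys)
    then show ?thesis using Cons.prems by (simp add: upt_conv_Cons del: upt_Suc)
  qed
qed simp

text \<open>Within a batch of siblings the size grows by one while the label drops. From one batch
  to the next, \<open>annotated_hd\<close> bounds the size by that of the last sibling.\<close>

lemma annotated_successively:
  assumes "nfs_run new vis pend ev"
    and "\<And>a ws ps. (a, ws, ps) \<in> set ev \<Longrightarrow> sorted_wrt (>) ws"
  shows "successively (\<lambda>(v, j) (w, k). k \<le> j \<or> k = Suc j \<and> w < v) (annotated ev)"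
  using assms
proof (induction rule: nfs_run.induct)
  case (Cons vis ws ps ev a)
  let ?R = "\<lambda>(v, j) (w, k). k \<le> j \<or> k = Suc j \<and> w < (v::nat)"
  let ?z = "zip ws [length ps..<length ps + length ws]"
  have ws: "sorted_wrt (>) ws"
    using Cons.prems by auto
  have "successively ?R ?z"
    unfolding successively_conv_nth using ws by (auto simp: sorted_wrt_iff_nth_less)
  moreover have "successively ?R (annotated ev)"
    using Cons by auto
  moreover have "?R (last ?z) (hd (annotated ev))" if ne: "ws \<noteq> []" "annotated ev \<noteq> []"
  proof -
    obtain w k xs where hd: "annotated ev = (w, k) # xs"
      using ne by (metis list.exhaust surj_pair)
    then have "k \<le> length ps + length ws - 1"
      using annotated_hd [OF Cons.hyps(1)] by fastforce
    moreover have "last ?z = (last ws, length ps + length ws - 1)"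
      using ne by (simp add: last_zip)
    ultimately show ?thesis by (simp add: hd)
  qed
  ultimately show ?case
    by (auto simp: successively_append_iff)
qed simp

lemma annotated_inj:
  assumes "nfs_run new vis pend ev" "nfs_run new' vis' pend ev'" "annotated ev = annotated ev'"
  shows "ev = ev'"
  using assms
proof (induction arbitrary: vis' ev' rule: nfs_run.induct)
  case (Nil vis)
  then show ?case by (auto elim: nfs_run.cases)
next
  case (Cons vis ws ps ev a)
  from Cons.prems(1) obtain ws' ev1 where ev': "ev' = (a, ws', ps) # ev1"
    and run': "nfs_run new' (vis' @ ws') (rev ws' @ ps) ev1"
    by (auto elim: nfs_run.cases)
  let ?z = "\<lambda>ws. zip ws [length ps..<length ps + length ws]"
  have eq: "?z ws @ annotated ev = ?z ws' @ annotated ev1"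
    using Cons.prems(2) by (simp add: ev')
  \<comment> \<open>If the batch \<open>us\<close> ended before \<open>us'\<close>, the first size
    recorded after it would be \<open>length ps + length us\<close>, one more than
    \<open>annotated_hd\<close> allows.\<close>
  have no: False if run: "nfs_run nw vs (rev us @ ps) e" and eq: "?z us @ annotated e = ?z us' @ annotated e'"
    and less: "length us < length us'" for us us' e e' nw vs
  proof -
    have "annotated e = drop (length us) (?z us') @ annotated e'"
      using arg_cong [OF eq, of "drop (length us)"] less by simp
    moreover have "drop (length us) (?z us') = (us' ! length us, length ps + length us) # drop (Suc (length us)) (?z us')"
      using less by (subst Cons_nth_drop_Suc [symmetric]) auto
    ultimately have "length ps + length us < length (rev us @ ps)"
      using annotated_hd [OF run] by (metis append_Cons)
    then show False by simp
  qed
  have "length ws = length ws'"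
    using no [OF Cons.hyps(1) eq] no [OF run' eq [symmetric]] by (metis linorder_neqE_nat)
  then have "?z ws = ?z ws'" "annotated ev = annotated ev1"
    using eq by simp_all
  then have "ws = ws'"
    by (metis \<open>length ws = length ws'\<close> diff_add_inverse length_upt map_fst_zip)
  then show ?case
    using Cons.IH run' \<open>annotated ev = annotated ev1\<close> ev' by blast
qed

section \<open>Rooted forests and cane paths\<close>

lemma adjacent_sym: "adjacent G u v \<longleftrightarrow> adjacent G v u"
  by (simp add: adjacent_def insert_commute)

lemma graph_cycle_adjacent:
  assumes "graph_cycle G p" "i < length p"
  shows "adjacent G (p ! i) (p ! (Suc i mod length p))"
proof (cases "Suc i < length p")
  case True
  then show ?thesis
    using assms by (auto simp: graph_cycle_def graph_path_def successively_conv_nth)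
next
  case False
  then have "Suc i = length p" using assms(2) by simp
  moreover from this have "p ! i = last p" "p ! 0 = hd p"
    by (metis diff_Suc_1 last_conv_nth length_0_conv nat.simps(3), metis hd_conv_nth length_0_conv nat.simps(3))
  ultimately show ?thesis
    using assms(1) by (simp add: graph_cycle_def)
qed

definition canes :: "edges \<Rightarrow> nat \<Rightarrow> nat list set" where
  "canes F w = {p. cane_path F p \<and> hd p = w}"

definition cane_ends :: "edges \<Rightarrow> nat \<Rightarrow> nat set" where
  "cane_ends F w = last ` canes F w"

text \<open>\<open>chi a w\<close> stands for: \<open>a\<close> is the parent of \<open>w\<close>. A
  rank growing from parent to child replaces acyclicity and supports inductions down the trees. The
  locale translates the path-based notions of the definitions into statements about
  \<open>chi\<close>.\<close>

locale rooted_forest =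
  fixes n :: nat and F :: edges and chi :: "nat \<Rightarrow> nat \<Rightarrow> bool" and rk :: "nat \<Rightarrow> nat"
  assumes F_eq: "F = {{a, w} | a w. chi a w}"
    and chi_V: "chi a w \<Longrightarrow> a \<in> {1..n+1} \<and> w \<in> {1..n+1}"
    and chi_unique: "chi a w \<Longrightarrow> chi b w \<Longrightarrow> a = b"
    and chi_rank: "chi a w \<Longrightarrow> rk a < rk w"
    and top_max: "\<nexists>b. chi b r \<Longrightarrow> chi\<^sup>*\<^sup>* r v \<Longrightarrow> v \<le> r"
begin

lemma adjacent_iff: "adjacent F u v \<longleftrightarrow> chi u v \<or> chi v u"
  unfolding adjacent_def F_eq by (auto simp: doubleton_eq_iff)

lemma top_exists: "\<exists>r. (\<nexists>b. chi b r) \<and> chi\<^sup>*\<^sup>* r v"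
proof (induction "rk v" arbitrary: v rule: less_induct)
  case less
  then show ?case
    by (metis chi_rank rtranclp.simps)
qed

lemma component_of_top:
  assumes "\<nexists>b. chi b r" "chi\<^sup>*\<^sup>* r v"
  shows "component F v = {u. chi\<^sup>*\<^sup>* r u}"
proof (intro subset_antisym subsetI)
  fix u assume "u \<in> component F v"
  then have "(adjacent F)\<^sup>*\<^sup>* v u" by (simp add: component_def)
  then have "chi\<^sup>*\<^sup>* r u"
  proof (induction rule: rtranclp_induct)
    case (step u w)
    \<comment> \<open>An edge from a descendant of \<open>r\<close> leads to a child or to the only
      parent, which is again a descendant because \<open>r\<close> has no parent.\<close>
    then show ?case
      unfolding adjacent_iff by (metis assms(1) chi_unique rtranclp.simps)
  qed (rule assms)
  then show "u \<in> {u. chi\<^sup>*\<^sup>* r u}" by simp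
next
  have down: "(adjacent F)\<^sup>*\<^sup>* r u" if "chi\<^sup>*\<^sup>* r u" for u
    using that by (rule rtranclp_mono [THEN predicate2D, rotated]) (simp add: adjacent_iff predicate2I)
  have "symp (adjacent F)"
    by (simp add: symp_def adjacent_sym)
  then have "(adjacent F)\<^sup>*\<^sup>* v r"
    using down [OF assms(2)] by (metis symp_rtranclp sympD)
  moreover fix u assume "u \<in> {u. chi\<^sup>*\<^sup>* r u}"
  ultimately show "u \<in> component F v"
    using down by (auto simp: component_def intro: rtranclp_trans)
qed

lemma root_of_eq:
  assumes "\<nexists>b. chi b r" "chi\<^sup>*\<^sup>* r v"
  shows "root_of F v = r"
proof -
  have "{u. chi\<^sup>*\<^sup>* r u} \<subseteq> {..r}"
    using top_max assms(1) by auto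
  then have "finite {u. chi\<^sup>*\<^sup>* r u}"
    by (rule finite_subset) simp
  then show ?thesis
    unfolding root_of_def component_of_top [OF assms] using top_max [OF assms(1)]
    by (intro Max_eqI) auto
qed

lemma root_of_top: "\<nexists>b. chi b (root_of F v)" "chi\<^sup>*\<^sup>* (root_of F v) v"
  using top_exists [of v] root_of_eq by blast+

lemma root_of_chi:
  assumes "chi a w"
  shows "root_of F w = root_of F a"
  using root_of_top [of a] assms by (meson root_of_eq rtranclp.rtrancl_into_rtrancl)

lemma root_of_self_iff: "root_of F v = v \<longleftrightarrow> (\<nexists>b. chi b v)"
  using root_of_top(1) [of v] root_of_eq [of v v] by auto

lemma root_of_root_of: "root_of F (root_of F v) = root_of F v"
  using root_of_top(1) root_of_self_iff by blast

lemma root_of_ge: "v \<le> root_of F v"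
  using top_max root_of_top by blast

lemma root_of_in: "v \<in> {1..n+1} \<Longrightarrow> root_of F v \<in> {1..n+1}"
  using root_of_top(2) [of v] by (metis chi_V converse_rtranclpE)

text \<open>Once a path has stepped to a child it cannot turn up again, since the only way up is the
  node just left. Hence it never reaches a root, which is why a child is not mistaken for a parent
  in \<open>parent_of_iff\<close>.\<close>

lemma path_down: "graph_path F (a # w # q) \<Longrightarrow> chi a w \<Longrightarrow> \<exists>b. chi b (last (w # q))"
proof (induction q arbitrary: a w)
  case (Cons x q)
  then have "graph_path F (w # x # q)" "adjacent F w x" "x \<noteq> a"
    by (auto simp: graph_path_def)
  moreover from this have "chi w x"
    using Cons.prems(2) chi_unique adjacent_iff by blast
  ultimately show ?case
    using Cons.IH by simp
qed auto

text \<open>The rank bound keeps the path free of repetitions when it is extended at its lower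
  end.\<close>

lemma path_up:
  "chi\<^sup>*\<^sup>* r v \<Longrightarrow> \<exists>q. graph_path F (v # q) \<and> last (v # q) = r \<and> (\<forall>x\<in>set q. rk x < rk v)"
proof (induction rule: rtranclp_induct)
  case base
  then show ?case
    by (intro exI [of _ "[]"]) (simp add: graph_path_def)
next
  case (step u v)
  then obtain q where q: "graph_path F (u # q)" "last (u # q) = r" "\<forall>x\<in>set q. rk x < rk u"
    by blast
  have "rk u < rk v" "adjacent F v u"
    using step chi_rank adjacent_iff by auto
  then have "graph_path F (v # u # q) \<and> last (v # u # q) = r \<and> (\<forall>x\<in>set (u # q). rk x < rk v)"
    using q by (auto simp: graph_path_def)
  then show ?case by blast
qed

lemma parent_of_iff: "parent_of F v u \<longleftrightarrow> chi u v"
proof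
  assume "parent_of F v u"
  then obtain q where q: "graph_path F (v # u # q)" "last (u # q) = root_of F v"
    by (auto simp: parent_of_def)
  then have "\<not> chi v u"
    using path_down root_of_top(1) by metis
  then show "chi u v"
    using q(1) by (auto simp: graph_path_def adjacent_iff)
next
  assume "chi u v"
  obtain q where q: "graph_path F (u # q)" "last (u # q) = root_of F u" "\<forall>x\<in>set q. rk x < rk u"
    using path_up root_of_top(2) by blast
  have "rk u < rk v" "adjacent F v u"
    using \<open>chi u v\<close> chi_rank adjacent_iff by auto
  then have "graph_path F (v # u # q)"
    using q by (auto simp: graph_path_def)
  then show "parent_of F v u"
    unfolding parent_of_def using q(2) root_of_chi [OF \<open>chi u v\<close>] by (metis)
qed

text \<open>At a node of largest rank on a cycle both neighbours along the cycle would be its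
  parent, but they are different since the cycle has length at least 3.\<close>

lemma no_cycle: "\<not> graph_cycle F p"
proof
  assume cyc: "graph_cycle F p"
  define m where "m = length p"
  have m: "m \<ge> 3" and dist: "distinct p"
    using cyc by (auto simp: graph_cycle_def graph_path_def m_def)
  have "Max (rk ` set p) \<in> rk ` set p"
    using m by (intro Max_in) (auto simp: m_def)
  then obtain i where "i < m" and max: "rk (p ! i) = Max (rk ` set p)"
    by (auto simp: m_def in_set_conv_nth)
  have i: "i < m" "\<And>x. x \<in> set p \<Longrightarrow> rk x \<le> rk (p ! i)"
    unfolding max using \<open>i < m\<close> by auto
  define j where "j = (if i = 0 then m - 1 else i - 1)"
  have j: "j < m" "Suc j mod m = i"
    using i m by (auto simp: j_def)
  have neq: "Suc i mod m \<noteq> j"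
  proof (cases "Suc i = m")
    case True
    then show ?thesis using m by (simp add: j_def)
  next
    case False
    then have "Suc i mod m = Suc i" using i by simp
    then show ?thesis using m by (auto simp: j_def split: if_splits)
  qed
  have parent: "chi (p ! k) (p ! i)" if "k < m" "adjacent F (p ! k) (p ! i)" for k
    using that i(2) [of "p ! k"] chi_rank adjacent_iff by (metis m_def not_less nth_mem)
  have k: "Suc i mod m < m" using m by simp
  have "chi (p ! j) (p ! i)"
    using parent [OF j(1)] graph_cycle_adjacent [OF cyc, of j] j by (simp add: m_def)
  moreover have "chi (p ! (Suc i mod m)) (p ! i)"
    using parent [OF k] graph_cycle_adjacent [OF cyc, of i] i(1) adjacent_sym by (simp add: m_def)
  ultimately have "p ! j = p ! (Suc i mod m)"
    by (rule chi_unique)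
  then show False
    using dist j(1) k neq by (simp add: m_def nth_eq_iff_index_eq)
qed

lemma in_labeled_forests: "F \<in> labeled_forests n"
proof -
  have "E \<in> {{u, v} |u v. u \<in> {1..n + 1} \<and> v \<in> {1..n + 1} \<and> u \<noteq> v}" if "E \<in> F" for E
  proof -
    from that obtain a w where "E = {a, w}" "chi a w"
      unfolding F_eq by blast
    moreover from this have "a \<noteq> w" using chi_rank by blast
    ultimately show ?thesis
      using chi_V by blast
  qed
  then show ?thesis
    using no_cycle by (auto simp: labeled_forests_def labeled_graphs_def)
qed

lemma card_F: "card F = card {w. \<exists>a. chi a w}"
proof -
  define pa where "pa = (\<lambda>w. THE a. chi a w)"
  have pa: "pa w = a" if "chi a w" for a w
    unfolding pa_def using that chi_unique by blast
  have "F = (\<lambda>w. {pa w, w}) ` {w. \<exists>a. chi a w}"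
    unfolding F_eq using pa by auto
  \<comment> \<open>The rank tells which end of an edge is the child.\<close>
  moreover have "inj_on (\<lambda>w. {pa w, w}) {w. \<exists>a. chi a w}"
  proof (rule inj_onI)
    fix v w assume "v \<in> {w. \<exists>a. chi a w}" "w \<in> {w. \<exists>a. chi a w}" and eq: "{pa v, v} = {pa w, w}"
    then have "chi (pa v) v" "chi (pa w) w" using pa by auto
    then have "rk (pa v) < rk v" "rk (pa w) < rk w"
      by (auto intro: chi_rank)
    with eq show "v = w"
      unfolding doubleton_eq_iff using less_asym by metis
  qed
  ultimately show ?thesis by (simp add: card_image)
qed

section \<open>Recursion for cane paths\<close>

lemma canes_root: "\<nexists>a. chi a w \<Longrightarrow> canes F w = {}"
proof (rule ccontr)
  assume w: "\<nexists>a. chi a w" and "canes F w \<noteq> {}"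
  then obtain p k where "hd p = w" "k \<ge> 2" "length p = k + 1"
    "\<forall>i<k-1. parent_of F (p ! i) (p ! (i+1))"
    by (auto simp: canes_def cane_path_def)
  moreover from this have "p ! 0 = w"
    by (cases p) auto
  ultimately have "parent_of F w (p ! 1)"
    by (metis One_nat_def Suc_le_eq add_0 diff_Suc_1 less_diff_conv one_add_one plus_1_eq_Suc)
  then show False using w parent_of_iff by auto
qed

text \<open>A cane path starts by going up to the parent. There it either turns at once, to a
  sibling with larger label, or continues as a cane path of the parent.\<close>

lemma canes_chi:
  assumes w: "chi a w"
  shows "canes F w = (\<lambda>u. [w, a, u]) ` {u. chi a u \<and> w < u} \<union> (#) w ` canes F a" (is "_ = ?A \<union> ?B")
proof (intro subset_antisym subsetI)
  fix p assume "p \<in> canes F w"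
  then obtain k where p: "graph_path F p" "hd p = w" "k \<ge> 2" "length p = k + 1"
      "\<And>i. i < k - 1 \<Longrightarrow> chi (p ! (i+1)) (p ! i)"
      "chi (p ! (k-1)) (p ! k)" "p ! (k-2) < p ! k"
    by (auto simp: canes_def cane_path_def parent_of_iff)
  then obtain x q where p_eq: "p = w # x # q"
    by (cases p; cases "tl p") auto
  have "x = a"
    using p(5) [of 0] p(3) w chi_unique by (simp add: p_eq)
  show "p \<in> ?A \<union> ?B"
  proof (cases "k = 2")
    case True
    then obtain u where "q = [u]"
      using p(4) p_eq by (cases q) auto
    then show ?thesis
      using p True \<open>x = a\<close> by (auto simp: p_eq)
  next
    case False
    then obtain k' where k': "k = Suc k'" "k' \<ge> 2" using p(3) by (cases k) auto
    have "cane_path F (x # q)"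
      unfolding cane_path_def parent_of_iff
    proof (intro conjI exI [of _ k'])
      show "graph_path F (x # q)"
        using p(1) by (simp add: p_eq graph_path_def)
      show "\<forall>i<k' - 1. chi ((x # q) ! (i + 1)) ((x # q) ! i)"
      proof (intro allI impI)
        fix i assume "i < k' - 1"
        then show "chi ((x # q) ! (i + 1)) ((x # q) ! i)"
          using p(5) [of "Suc i"] k' by (simp add: p_eq)
      qed
      show "chi ((x # q) ! (k' - 1)) ((x # q) ! k')"
        using p(6) k' by (cases k') (simp_all add: p_eq)
      show "(x # q) ! (k' - 2) < (x # q) ! k'"
      proof -
        have "k - 2 = Suc (k' - 2)" using k' by simp
        then show ?thesis using p(7) k'(1) by (simp add: p_eq)
      qed
    qed (use p(4) k' p_eq in auto)
    then show ?thesis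
      using \<open>x = a\<close> by (auto simp: canes_def p_eq)
  qed
next
  fix p assume "p \<in> ?A \<union> ?B"
  then consider u where "p = [w, a, u]" "chi a u" "w < u" | q where "p = w # q" "q \<in> canes F a"
    by blast
  then show "p \<in> canes F w"
  proof cases
    case 1
    have "rk a < rk w" "rk a < rk u" using w 1 chi_rank by auto
    then have "graph_path F p"
      using 1 w by (auto simp: graph_path_def adjacent_iff)
    then have "cane_path F p"
      unfolding cane_path_def parent_of_iff using 1 w
      by (auto intro!: exI [of _ 2])
    then show ?thesis by (simp add: canes_def 1)
  next
    case 2
    then obtain k where q: "graph_path F q" "hd q = a" "k \<ge> 2" "length q = k + 1"
        "\<And>i. i < k - 1 \<Longrightarrow> chi (q ! (i+1)) (q ! i)"
        "chi (q ! (k-1)) (q ! k)" "q ! (k-2) < q ! k"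
      by (auto simp: canes_def cane_path_def parent_of_iff)
    have q0: "q ! 0 = a"
      using q(2,4) by (metis Suc_eq_plus1 hd_conv_nth length_0_conv nat.simps(3))
    have up: "rk (q ! i) \<le> rk a" if "i \<le> k - 1" for i
      using that
    proof (induction i)
      case (Suc i)
      then show ?case
        using chi_rank [OF q(5) [of i]] by simp
    qed (simp add: q0)
    \<comment> \<open>All nodes of \<open>q\<close> but the last have rank at most that of
      \<open>a\<close>, hence below that of \<open>w\<close>. If the last one were \<open>w\<close>,
      its parent \<open>q ! (k - 1)\<close> would be \<open>a\<close>, which is already
      \<open>q ! 0\<close>.\<close>
    have "w \<notin> set q"
    proof
      assume "w \<in> set q"
      then obtain i where i: "i \<le> k" "q ! i = w"
        using q(4) by (auto simp: in_set_conv_nth less_Suc_eq_le)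
      show False
      proof (cases "i = k")
        case True
        then have "q ! (k - 1) = q ! 0"
          using q(6) i w chi_unique q0 by auto
        then show False
          using q(1,3,4) by (auto simp: graph_path_def nth_eq_iff_index_eq)
      next
        case False
        then show False
          using up [of i] i chi_rank [OF w] by fastforce
      qed
    qed
    moreover have "q \<noteq> []" using q(4) by auto
    ultimately have "graph_path F p"
      using q(1,2) w 2(1) by (cases q) (auto simp: graph_path_def adjacent_iff)
    moreover have "chi (p ! (i + 1)) (p ! i)" if "i < Suc k - 1" for i
      using that q(5) [of "i - 1"] w q0 2(1) by (cases i) auto
    moreover have "p ! (Suc k - 2) < p ! Suc k"
    proof -
      have "Suc k - 2 = Suc (k - 2)" using q(3) by simp
      then show ?thesis using q(7) 2(1) by simp
    qed
    moreover have "chi (p ! (Suc k - 1)) (p ! Suc k)"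
      using q(3,6) 2(1) by (cases k) auto
    ultimately have "cane_path F p"
      unfolding cane_path_def parent_of_iff using q(3,4) 2(1)
      by (intro conjI exI [of _ "Suc k"]) auto
    then show ?thesis by (simp add: canes_def 2)
  qed
qed

lemma canes_length: "p \<in> canes F w \<Longrightarrow> length p \<ge> 3"
  by (auto simp: canes_def cane_path_def)

lemma finite_children: "finite {u. chi a u \<and> P u}"
  by (rule finite_subset [of _ "{1..n+1}"]) (use chi_V in auto)

lemma finite_canes: "finite (canes F w)"
proof (induction "rk w" arbitrary: w rule: less_induct)
  case less
  show ?case
  proof (cases "\<exists>a. chi a w")
    case True
    then obtain a where a: "chi a w" by blast
    then have "finite (canes F a)"
      using less chi_rank by blast
    then show ?thesis
      unfolding canes_chi [OF a] using finite_children by simp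
  qed (simp add: canes_root)
qed

lemma cane_paths_from_root: "\<nexists>a. chi a w \<Longrightarrow> cane_paths_from F w = 0 \<and> cane_ends F w = {}"
  using canes_root [of w] by (simp add: cane_paths_from_def cane_ends_def canes_def [symmetric])

lemma cane_paths_from_chi:
  assumes "chi a w"
  shows "cane_paths_from F w = card {u. chi a u \<and> w < u} + cane_paths_from F a"
proof -
  \<comment> \<open>Lists of length 3 on one side, of length at least 4 on the other.\<close>
  have "(\<lambda>u. [w, a, u]) ` {u. chi a u \<and> w < u} \<inter> (#) w ` canes F a = {}"
    using canes_length by fastforce
  moreover have "card ((\<lambda>u. [w, a, u]) ` {u. chi a u \<and> w < u}) = card {u. chi a u \<and> w < u}"
    by (rule card_image) (auto simp: inj_on_def)
  moreover have "card ((#) w ` canes F a) = card (canes F a)"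
    by (rule card_image) (auto simp: inj_on_def)
  ultimately show ?thesis
    unfolding cane_paths_from_def canes_def [symmetric] canes_chi [OF assms]
    using finite_children finite_canes by (simp add: card_Un_disjoint)
qed

lemma cane_ends_chi:
  assumes "chi a w"
  shows "cane_ends F w = {u. chi a u \<and> w < u} \<union> cane_ends F a"
proof -
  have "last ` (#) w ` canes F a = last ` canes F a"
    unfolding image_image using canes_length by (intro image_cong) fastforce+
  then show ?thesis
    unfolding cane_ends_def canes_chi [OF assms] image_Un by (simp add: image_image)
qed

lemma cane_paths_eq: "\<alpha> F = (\<Sum>v\<in>{1..n+1}. cane_paths_from F v)"
proof -
  have "{p. cane_path F p} = (\<Union>v\<in>{1..n+1}. canes F v)"
  proof -
    have "hd p \<in> {1..n+1}" if "cane_path F p" for p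
    proof -
      have "p \<in> canes F (hd p)" using that by (simp add: canes_def)
      then obtain a where "chi a (hd p)"
        using canes_root by blast
      then show ?thesis using chi_V by blast
    qed
    then show ?thesis by (auto simp: canes_def)
  qed
  moreover have "card (\<Union>v\<in>{1..n+1}. canes F v) = (\<Sum>v\<in>{1..n+1}. card (canes F v))"
    by (rule card_UN_disjoint) (auto simp: finite_canes, auto simp: canes_def)
  ultimately show ?thesis
    by (simp add: cane_paths_def cane_paths_from_def canes_def)
qed

end

section \<open>The search forest of a graph\<close>

lemma nfs_run_within:
  assumes "nfs_run (unvisited_neighbours G) vis pend ev"
    and "\<And>a. finite {w. adjacent G a w}"
    and "set pend \<subseteq> K" "\<And>a w. a \<in> K \<Longrightarrow> adjacent G a w \<Longrightarrow> w \<in> K"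
  shows "set (map fst ev) \<subseteq> K"
  using assms(1,3)
proof (induction rule: nfs_run.induct)
  case (Cons vis ws ps ev a)
  have "set ws \<subseteq> {w. adjacent G a w}"
    using assms(2) by (auto simp: Cons.hyps(2) unvisited_neighbours_def)
  then have "set (rev ws @ ps) \<subseteq> K"
    using Cons.prems assms(4) by auto
  then show ?case
    using Cons by auto
qed simp

lemma wf_events_discovered: "wf_events ev \<Longrightarrow> set (discovered ev) \<subseteq> set (map fst ev)"
  by (induction ev rule: wf_events.induct) auto

lemma wf_events_distinct: "wf_events ev \<Longrightarrow> distinct (map fst ev)"
  by (induction ev rule: wf_events.induct) auto

lemma wf_events_append:
  assumes "wf_events ev1" "wf_events ev2" "set (map fst ev1) \<inter> set (map fst ev2) = {}"
  shows "wf_events (ev1 @ ev2)"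
  using assms
proof (induction ev1 rule: wf_events.induct)
  case (2 a ws ps ev)
  moreover have "discovered (ev @ ev2) = discovered ev @ discovered ev2"
    by (simp add: discovered_def)
  ultimately show ?case
    using wf_events_discovered [of ev2] by auto
qed simp

text \<open>The time at which a node becomes active. It is the rank of the search forest, and it
  also orients the edges that join the ends of cane paths.\<close>

definition activation :: "event list \<Rightarrow> nat \<Rightarrow> nat" where
  "activation ev v = length (takeWhile (\<lambda>x. x \<noteq> v) (map fst ev))"

lemma activation_Cons: "activation (e # ev) v = (if fst e = v then 0 else Suc (activation ev v))"
  by (simp add: activation_def)

lemma wf_events_later:
  "wf_events ev \<Longrightarrow> (a, ws, ps) \<in> set ev \<Longrightarrow> set ws \<union> set ps \<subseteq> set (map fst ev)"
  by (induction ev rule: wf_events.induct) auto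

lemma activation_less:
  "wf_events ev \<Longrightarrow> (a, ws, ps) \<in> set ev \<Longrightarrow> w \<in> set ws \<union> set ps \<Longrightarrow> activation ev a < activation ev w"
proof (induction ev rule: wf_events.induct)
  case (2 b us qs ev)
  show ?case
  proof (cases "(a, ws, ps) \<in> set ev")
    case True
    have wf: "wf_events ev" "b \<notin> set (map fst ev)"
      using 2(2) by auto
    have "a \<in> set (map fst ev)"
      using True by force
    then have "a \<noteq> b" "w \<noteq> b"
      using wf wf_events_later [OF wf(1) True] 2(4) by auto
    moreover have "activation ev a < activation ev w"
      using 2(1) wf(1) True 2(4) by blast
    ultimately show ?thesis
      by (simp add: activation_Cons)
  next
    case False
    then have "(a, ws, ps) = (b, us, qs)"
      using 2(3) by simp
    moreover from this have "w \<noteq> b"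
      using 2(2,4) by auto
    ultimately show ?thesis
      by (simp add: activation_Cons)
  qed
qed simp

lemma discovers_unique: "wf_events ev \<Longrightarrow> discovers ev a w \<Longrightarrow> discovers ev b w \<Longrightarrow> a = b"
proof (induction ev rule: wf_events.induct)
  case (2 c ws ps ev)
  have "w \<notin> set ws" if "discovers ev x w" for x
    using that 2(2) set_discovered [of w ev] by auto
  then show ?case using 2 by auto
qed simp

lemma wf_events_disjoint: "wf_events ev \<Longrightarrow> (a, ws, ps) \<in> set ev \<Longrightarrow> distinct (ws @ ps)"
  by (induction ev rule: wf_events.induct) auto

lemma discovers_event:
  assumes "wf_events ev" "(a, ws, ps) \<in> set ev"
  shows "discovers ev a w \<longleftrightarrow> w \<in> set ws"
proof
  assume "discovers ev a w"
  then obtain us qs where "(a, us, qs) \<in> set ev" "w \<in> set us"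
    by (auto simp: discovers_def)
  moreover from this have "(us, qs) = (ws, ps)"
    using assms(2) eq_key_imp_eq_value [OF wf_events_distinct [OF assms(1)]] by blast
  ultimately show "w \<in> set ws" by simp
next
  show "w \<in> set ws \<Longrightarrow> discovers ev a w"
    unfolding discovers_def using assms(2) by blast
qed

lemma rev_sorted_list_of_set: "sorted_wrt (>) ws \<Longrightarrow> rev (sorted_list_of_set (set ws)) = (ws :: nat list)"
proof -
  assume ws: "sorted_wrt (>) ws"
  then have "sorted_wrt (<) (rev ws)"
    by (simp add: sorted_wrt_rev)
  then have "sorted_list_of_set (set (rev ws)) = rev ws"
    using sorted_list_of_set.idem_if_sorted_distinct strict_sorted_iff by blast
  then show ?thesis by simp
qed

definition search_events :: "edges \<Rightarrow> nat \<Rightarrow> event list" where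
  "search_events G r = (SOME ev. nfs_run (unvisited_neighbours G) [r] [r] ev)"

definition all_events :: "nat \<Rightarrow> edges \<Rightarrow> event list" where
  "all_events n G = concat (map (search_events G) (roots n G))"

locale labeled_graph =
  fixes n :: nat and G :: edges
  assumes G: "G \<in> labeled_graphs n"
begin

abbreviation V :: "nat set" where "V \<equiv> {1..n+1}"

lemma adjacent_V: "adjacent G u v \<Longrightarrow> u \<in> V \<and> v \<in> V \<and> u \<noteq> v"
proof -
  assume "adjacent G u v"
  then have "{u, v} \<in> {{u, v} |u v. u \<in> V \<and> v \<in> V \<and> u \<noteq> v}"
    using G by (auto simp: adjacent_def labeled_graphs_def)
  then show ?thesis by (auto simp: doubleton_eq_iff)
qed

lemma finite_neighbours: "finite {w. adjacent G a w}"
  by (rule finite_subset [of _ V]) (use adjacent_V in auto)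

lemma new_nodes:
  "set (unvisited_neighbours G a vis) = {w. adjacent G a w} - set vis"
  "sorted_wrt (>) (unvisited_neighbours G a vis)"
  "distinct (unvisited_neighbours G a vis)"
  using finite_neighbours by (auto simp: unvisited_neighbours_def sorted_wrt_rev)

lemma search_run: "nfs_run (unvisited_neighbours G) [r] [r] (search_events G r)"
  unfolding search_events_def
proof (rule someI_ex, rule nfs_run_exists [of V])
  show "set (unvisited_neighbours G a vis) \<subseteq> V - set vis" for a vis
    using adjacent_V by (auto simp: new_nodes)
qed (simp_all add: new_nodes)

lemma search_wf:
  "wf_events (search_events G r)"
  "set (map fst (search_events G r)) = insert r (set (discovered (search_events G r)))"
  "r \<notin> set (discovered (search_events G r))"
  using nfs_run_wf [OF search_run [of r]] by (auto simp: new_nodes)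

lemma component_closed: "a \<in> component G r \<Longrightarrow> adjacent G a w \<Longrightarrow> w \<in> component G r"
  by (auto simp: component_def intro: rtranclp.rtrancl_into_rtrancl)

lemma component_cong: "v \<in> component G r \<Longrightarrow> component G v = component G r"
proof -
  assume "v \<in> component G r"
  then have "(adjacent G)\<^sup>*\<^sup>* r v" by (simp add: component_def)
  moreover from this have "(adjacent G)\<^sup>*\<^sup>* v r"
    using adjacent_sym by (metis sympD sympI symp_rtranclp)
  ultimately show ?thesis
    by (auto simp: component_def intro: rtranclp_trans)
qed

lemma component_V: "v \<in> V \<Longrightarrow> component G v \<subseteq> V"
proof
  fix u assume "v \<in> V" "u \<in> component G v"
  then have "(adjacent G)\<^sup>*\<^sup>* v u" by (simp add: component_def)
  then show "u \<in> V"
    using \<open>v \<in> V\<close> by (induction rule: rtranclp_induct) (use adjacent_V in auto)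
qed

lemma root_of_component: "v \<in> V \<Longrightarrow> root_of G v \<in> component G v"
  unfolding root_of_def using component_V
  by (intro Max_in) (auto simp: component_def intro: finite_subset)

lemma root_of_cong: "v \<in> component G r \<Longrightarrow> root_of G v = root_of G r"
  by (simp add: root_of_def component_cong)

lemma set_roots: "set (roots n G) = root_of G ` V"
  by (simp add: roots_def)

lemma distinct_roots: "distinct (roots n G)" "sorted_wrt (>) (roots n G)"
  by (simp_all add: roots_def sorted_wrt_rev)

lemma root_of_root: "r \<in> set (roots n G) \<Longrightarrow> r \<in> V \<and> root_of G r = r"
  using root_of_component root_of_cong component_V unfolding set_roots by blast

lemma component_le_root: "r \<in> set (roots n G) \<Longrightarrow> v \<in> component G r \<Longrightarrow> v \<le> r"
  using root_of_root [of r] component_V [of r] unfolding root_of_def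
  by (metis Max_ge finite_atLeastAtMost finite_subset)

lemma actives_component: "set (map fst (search_events G r)) = component G r"
proof
  show "set (map fst (search_events G r)) \<subseteq> component G r"
    by (rule nfs_run_within [OF search_run finite_neighbours])
       (use component_closed in \<open>auto simp: component_def\<close>)
  show "component G r \<subseteq> set (map fst (search_events G r))"
  proof
    fix v assume "v \<in> component G r"
    then have "(adjacent G)\<^sup>*\<^sup>* r v" by (simp add: component_def)
    then show "v \<in> set (map fst (search_events G r))"
    proof (induction rule: rtranclp_induct)
      case base
      then show ?case using search_wf(2) by simp
    next
      case (step u w)
      have "w \<in> set [r] \<or> w \<in> set (discovered (search_events G r))"
        using nfs_run_closed [OF search_run finite_neighbours step(3,2)] .
      then show ?case using search_wf(2) by auto
    qed
  qed
qed

lemma components_disjoint: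
  assumes "r \<in> set (roots n G)" "r' \<in> set (roots n G)" "v \<in> component G r" "v \<in> component G r'"
  shows "r = r'"
  using assms root_of_cong root_of_root by metis

lemma all_events_wf: "wf_events (all_events n G)"
proof -
  have "wf_events (concat (map (search_events G) rs))"
    if "distinct rs" "set rs \<subseteq> set (roots n G)" for rs
    using that
  proof (induction rs)
    case (Cons r rs)
    have "set (map fst (search_events G r)) \<inter> set (map fst (concat (map (search_events G) rs))) = {}"
      using Cons.prems components_disjoint actives_component by (fastforce simp: image_iff)
    moreover have "wf_events (concat (map (search_events G) rs))"
      using Cons by simp
    ultimately show ?case
      using wf_events_append [OF search_wf(1)] by simp
  qed simp
  then show ?thesis
    unfolding all_events_def using distinct_roots by blast
qed

lemma all_events_iff: "e \<in> set (all_events n G) \<longleftrightarrow> (\<exists>r\<in>set (roots n G). e \<in> set (search_events G r))"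
  by (auto simp: all_events_def)

lemma component_exists:
  assumes v: "v \<in> V"
  shows "\<exists>r\<in>set (roots n G). v \<in> component G r"
proof -
  have "v \<in> component G v" by (simp add: component_def)
  then have "v \<in> component G (root_of G v)"
    using root_of_component [OF v] component_cong by blast
  then show ?thesis
    using v by (auto simp: set_roots)
qed

lemma actives_all: "set (map fst (all_events n G)) = V"
proof -
  have "set (map fst (all_events n G)) = (\<Union>r\<in>set (roots n G). component G r)"
    using actives_component by (force simp: all_events_def)
  also have "\<dots> = V"
  proof (intro subset_antisym subsetI)
    fix v assume "v \<in> (\<Union>r\<in>set (roots n G). component G r)"
    then show "v \<in> V" using root_of_root component_V by blast
  qed (use component_exists in blast)
  finally show ?thesis .
qed

abbreviation chi :: "nat \<Rightarrow> nat \<Rightarrow> bool" where "chi \<equiv> discovers (all_events n G)"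

lemma chi_iff: "chi a w \<longleftrightarrow> (\<exists>r\<in>set (roots n G). discovers (search_events G r) a w)"
  unfolding discovers_def all_events_iff by blast

lemma chi_adjacent: "chi a w \<Longrightarrow> adjacent G a w"
  using nfs_run_event [OF search_run] new_nodes(1) unfolding discovers_def all_events_iff
  by (metis (no_types, lifting) DiffD1 mem_Collect_eq)

lemma search_forest_eq: "\<Phi> n G = {{a, w} | a w. chi a w}"
  unfolding search_forest_def nfs_component_eq [OF search_run] chi_iff by auto

lemma search_forest_subset: "\<Phi> n G \<subseteq> G"
  unfolding search_forest_eq using chi_adjacent by (auto simp: adjacent_def)

lemma not_root_iff: "(\<exists>a. chi a v) \<longleftrightarrow> v \<in> V \<and> v \<notin> set (roots n G)"
proof
  assume "\<exists>a. chi a v"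
  then obtain a r where r: "r \<in> set (roots n G)" "discovers (search_events G r) a v" "chi a v"
    by (auto simp: chi_iff)
  then have disc: "v \<in> set (discovered (search_events G r))"
    by (auto simp: set_discovered)
  then have "v \<in> component G r" "v \<noteq> r"
    using search_wf(2,3) [of r] actives_component [of r] by auto
  moreover have "v \<in> component G v" by (simp add: component_def)
  ultimately show "v \<in> V \<and> v \<notin> set (roots n G)"
    using r chi_adjacent adjacent_V components_disjoint by blast
next
  assume v: "v \<in> V \<and> v \<notin> set (roots n G)"
  then obtain r where r: "r \<in> set (roots n G)" "v \<in> set (map fst (search_events G r))"
    using component_exists actives_component by blast
  then have "v \<in> set (discovered (search_events G r))"
    using v search_wf(2) by auto
  then show "\<exists>a. chi a v"
    using r(1) by (auto simp: chi_iff set_discovered)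
qed

text \<open>Discovery is the parent relation of the search forest. Its trees carry their largest
  label on top because each component is searched from there.\<close>

sublocale forest: rooted_forest n "\<Phi> n G" chi "activation (all_events n G)"
proof
  show "\<Phi> n G = {{a, w} | a w. chi a w}"
    by (rule search_forest_eq)
  show "a \<in> V \<and> w \<in> V" if "chi a w" for a w
    using chi_adjacent [OF that] adjacent_V by blast
  show "a = b" if "chi a w" "chi b w" for a b w
    using discovers_unique [OF all_events_wf] that by blast
  show "activation (all_events n G) a < activation (all_events n G) w" if "chi a w" for a w
    using that activation_less [OF all_events_wf] by (auto simp: discovers_def)
  show "v \<le> r" if "\<nexists>b. chi b r" "chi\<^sup>*\<^sup>* r v" for r v
  proof (cases "r \<in> V")
    case True
    then have "r \<in> set (roots n G)"
      using not_root_iff that(1) by blast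
    moreover have "(adjacent G)\<^sup>*\<^sup>* r v"
      using that(2) by (rule rtranclp_mono [THEN predicate2D, rotated]) (simp add: chi_adjacent predicate2I)
    ultimately show ?thesis
      using component_le_root by (simp add: component_def)
  next
    case False
    then have "\<not> chi r w" for w
      using chi_adjacent adjacent_V by blast
    then show ?thesis
      using that(2) by (metis converse_rtranclpE order_refl)
  qed
qed

section \<open>A graph compared with its search forest\<close>

lemma root_of_forest: "v \<in> V \<Longrightarrow> root_of (\<Phi> n G) v = root_of G v"
proof -
  assume v: "v \<in> V"
  define r where "r = root_of (\<Phi> n G) v"
  have r: "\<nexists>b. chi b r" "chi\<^sup>*\<^sup>* r v"
    using forest.root_of_top [of v] by (auto simp: r_def)
  have "r \<in> V"
    using forest.root_of_in v by (simp add: r_def)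
  then have "r \<in> set (roots n G)"
    using r(1) not_root_iff by blast
  moreover have "(adjacent G)\<^sup>*\<^sup>* r v"
    using r(2) by (rule rtranclp_mono [THEN predicate2D, rotated]) (simp add: chi_adjacent predicate2I)
  then have "v \<in> component G r" by (simp add: component_def)
  ultimately have "root_of G v = r"
    using root_of_cong root_of_root by metis
  then show ?thesis by (simp add: r_def)
qed

lemma roots_forest: "roots n (\<Phi> n G) = roots n G"
proof -
  have "root_of (\<Phi> n G) ` V = root_of G ` V"
    by (rule image_cong) (simp_all add: root_of_forest)
  then show ?thesis by (simp add: roots_def)
qed

lemma event_sorted: "(a, ws, ps) \<in> set (all_events n G) \<Longrightarrow> sorted_wrt (>) ws"
  using nfs_run_event [OF search_run] new_nodes(2) all_events_iff by metis

lemma children_eq: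
  assumes "(a, ws, ps) \<in> set (all_events n G)"
  shows "children_right_to_left (\<Phi> n G) a = ws"
proof -
  have "{v. chi a v} = set ws"
    using discovers_event [OF all_events_wf assms] by auto
  then show ?thesis
    unfolding children_right_to_left_def forest.parent_of_iff
    by (simp add: rev_sorted_list_of_set event_sorted [OF assms])
qed

text \<open>The traversal of the plane forest \<open>\<Phi> n G\<close> repeats the search of
  \<open>G\<close> event by event, so the NFS positions of the forest are the times of visit in
  \<open>G\<close>.\<close>

lemma forest_run:
  "r \<in> set (roots n G) \<Longrightarrow>
    nfs_run (\<lambda>a vis. children_right_to_left (\<Phi> n G) a) [r] [r] (search_events G r)"
  by (rule nfs_run_cong [OF search_run], rule children_eq) (auto simp: all_events_iff)

lemma nfs_order_eq:
  "nfs_order n (\<Phi> n G) = concat (map (\<lambda>r. r # discovered (search_events G r)) (roots n G))"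
  unfolding nfs_order_def roots_forest
  by (rule arg_cong [of _ _ concat], rule map_cong) (simp_all add: nfs_component_eq [OF forest_run])

text \<open>Children are visited by decreasing label, so the siblings at which a cane path from
  \<open>us ! i\<close> can end are exactly those visited before it. This is the recursion that
  \<open>nfs_run_stack\<close> asks for.\<close>

lemma event_canes:
  assumes e: "(b, us, qs) \<in> set (all_events n G)" and i: "i < length us"
  shows "cane_paths_from (\<Phi> n G) (us ! i) = i + cane_paths_from (\<Phi> n G) b \<and>
    cane_ends (\<Phi> n G) (us ! i) = set (take i us) \<union> cane_ends (\<Phi> n G) b"
proof -
  have us: "sorted_wrt (>) us"
    by (rule event_sorted [OF e])
  have chi: "chi b u \<longleftrightarrow> u \<in> set us" for u
    by (rule discovers_event [OF all_events_wf e])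
  have "{u. chi b u \<and> us ! i < u} = set (take i us)"
  proof (intro subset_antisym subsetI)
    fix u assume "u \<in> {u. chi b u \<and> us ! i < u}"
    then obtain j where j: "j < length us" "u = us ! j" "us ! i < us ! j"
      by (auto simp: chi in_set_conv_nth)
    then have "j < i"
      using us i by (metis linorder_neqE_nat not_less_iff_gr_or_eq sorted_wrt_nth_less)
    then show "u \<in> set (take i us)"
      using j i by (auto simp: in_set_conv_nth intro!: exI [of _ j])
  next
    fix u assume "u \<in> set (take i us)"
    then obtain j where "j < i" "u = us ! j"
      by (auto simp: in_set_conv_nth)
    then show "u \<in> {u. chi b u \<and> us ! i < u}"
      using i sorted_wrt_nth_less [OF us \<open>j < i\<close>] by (auto simp: chi)
  qed
  moreover have "distinct us"
    using wf_events_disjoint [OF all_events_wf e] by simp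
  then have "card (set (take i us)) = i"
    using i by (simp add: distinct_card)
  moreover have c: "chi b (us ! i)"
    using i chi by simp
  ultimately show "cane_paths_from (\<Phi> n G) (us ! i) = i + cane_paths_from (\<Phi> n G) b \<and> cane_ends (\<Phi> n G) (us ! i) = set (take i us) \<union> cane_ends (\<Phi> n G) b"
    using forest.cane_paths_from_chi [OF c] forest.cane_ends_chi [OF c] by simp
qed

lemma stack_canes:
  assumes "(a, ws, ps) \<in> set (all_events n G)"
  shows "cane_paths_from (\<Phi> n G) a = length ps \<and> cane_ends (\<Phi> n G) a = set ps"
proof -
  let ?cn = "cane_paths_from (\<Phi> n G)" and ?en = "cane_ends (\<Phi> n G)"
  obtain r where r: "r \<in> set (roots n G)" "(a, ws, ps) \<in> set (search_events G r)"
    using assms all_events_iff by blast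
  show ?thesis
  proof (rule nfs_run_stack [OF search_run _ _ r(2)])
    fix ys b zs assume "[r] = ys @ b # zs"
    then have "b = r" "zs = []" by (auto simp: Cons_eq_append_conv)
    then show "?cn b = length zs \<and> ?en b = set zs"
      using forest.cane_paths_from_root [of r] not_root_iff r(1) by auto
  next
    fix b us qs i assume e: "(b, us, qs) \<in> set (search_events G r)" and i: "i < length us"
    then show "?cn (us ! i) = i + ?cn b \<and> ?en (us ! i) = set (take i us) \<union> ?en b"
      using r(1) all_events_iff event_canes by blast
  qed
qed

lemma cane_edge_iff:
  "u \<in> cane_ends (\<Phi> n G) w \<longleftrightarrow> (\<exists>ws ps. (w, ws, ps) \<in> set (all_events n G) \<and> u \<in> set ps)"
proof
  assume u: "u \<in> cane_ends (\<Phi> n G) w"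
  then have "\<exists>a. chi a w"
    using forest.cane_paths_from_root by fastforce
  then have "w \<in> set (map fst (all_events n G))"
    using not_root_iff actives_all by simp
  then obtain ws ps where "(w, ws, ps) \<in> set (all_events n G)"
    by auto
  then show "\<exists>ws ps. (w, ws, ps) \<in> set (all_events n G) \<and> u \<in> set ps"
    using u stack_canes by auto
next
  assume "\<exists>ws ps. (w, ws, ps) \<in> set (all_events n G) \<and> u \<in> set ps"
  then show "u \<in> cane_ends (\<Phi> n G) w"
    using stack_canes by auto
qed

text \<open>One half of the description of a fiber. By \<open>nfs_run_edge\<close>, an edge joins an
  active node to a new child or to a node waiting on the stack, and the waiting nodes are ends of
  cane paths.\<close>

lemma graph_subset: "G \<subseteq> \<Phi> n G \<union> {{w, u} | w u. u \<in> cane_ends (\<Phi> n G) w}"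
proof
  fix E assume "E \<in> G"
  then obtain u v where E: "E = {u, v}" and uv: "u \<in> V" "v \<in> V" "u \<noteq> v"
    using G by (auto simp: labeled_graphs_def)
  then have adj: "adjacent G u v"
    using \<open>E \<in> G\<close> by (simp add: adjacent_def)
  obtain r where r: "r \<in> set (roots n G)" "u \<in> component G r"
    using uv(1) component_exists by blast
  have "v \<in> component G r"
    using r(2) adj component_closed by blast
  then obtain a ws ps w where "(a, ws, ps) \<in> set (search_events G r)" "{u, v} = {a, w}" "w \<in> set ws \<union> set ps"
    using nfs_run_edge [OF search_run [of r] finite_neighbours, of u v] r(2) adj uv(3)
    unfolding actives_component by auto
  then have e: "(a, ws, ps) \<in> set (all_events n G)" "E = {a, w}" "w \<in> set ws \<or> w \<in> set ps"
    using r(1) E all_events_iff by auto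
  then have "chi a w \<or> w \<in> cane_ends (\<Phi> n G) a"
    using stack_canes [OF e(1)] discovers_event [OF all_events_wf e(1)] by simp
  then show "E \<in> \<Phi> n G \<union> {{w, u} | w u. u \<in> cane_ends (\<Phi> n G) w}"
    unfolding search_forest_eq using e(2) by blast
qed

end

section \<open>The graphs with a given search forest\<close>

lemma path_exists:
  "(adjacent G)\<^sup>*\<^sup>* u v \<Longrightarrow> \<exists>p. graph_path G p \<and> hd p = u \<and> last p = v"
proof (induction rule: rtranclp_induct)
  case base
  then show ?case
    by (intro exI [of _ "[u]"]) (simp add: graph_path_def)
next
  case (step v w)
  then obtain p where p: "graph_path G p" "hd p = u" "last p = v" by blast
  show ?case
  proof (cases "w \<in> set p")
    case True
    then obtain xs ys where eq: "p = (xs @ [w]) @ ys" by (auto dest: split_list)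
    moreover have "hd (xs @ [w]) = u"
      using p(2) eq by (cases xs) auto
    ultimately have "graph_path G (xs @ [w]) \<and> hd (xs @ [w]) = u \<and> last (xs @ [w]) = w"
      using p unfolding graph_path_def by (simp add: successively_append_iff)
    then show ?thesis by blast
  next
    case False
    then have "graph_path G (p @ [w]) \<and> hd (p @ [w]) = u \<and> last (p @ [w]) = w"
      using p step(2) by (auto simp: graph_path_def successively_append_iff)
    then show ?thesis by blast
  qed
qed

lemma sum_Pow_power_card:
  fixes t :: "'a::comm_semiring_1"
  assumes "finite C"
  shows "(\<Sum>K\<in>Pow C. t ^ card K) = (1 + t) ^ card C"
  using prod_add [OF assms, of "\<lambda>_. t" "\<lambda>_. 1"] by (simp add: add.commute)

locale labeled_forest =
  fixes n :: nat and F :: edges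
  assumes F: "F \<in> labeled_forests n"

sublocale labeled_forest \<subseteq> labeled_graph n F
  by unfold_locales (use F in \<open>simp add: labeled_forests_def\<close>)

context labeled_forest
begin

text \<open>The search forest connects the two ends of every edge of \<open>F\<close>. An edge of
  \<open>F\<close> missing from it would therefore close a cycle. Hence all results about search
  forests apply to every labeled forest.\<close>

lemma search_forest_fixed: "\<Phi> n F = F"
proof (rule subset_antisym [OF search_forest_subset], rule subsetI, rule ccontr)
  fix E assume E: "E \<in> F" "E \<notin> \<Phi> n F"
  then obtain u v where uv: "E = {u, v}" "u \<in> V" "v \<in> V" "u \<noteq> v"
    using G by (auto simp: labeled_graphs_def)
  have adj: "adjacent F u v" "\<not> adjacent (\<Phi> n F) u v"
    using E uv(1) by (simp_all add: adjacent_def)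
  have "v \<in> component F u"
    using adj by (auto simp: component_def)
  then have same: "root_of (\<Phi> n F) v = root_of (\<Phi> n F) u"
    using root_of_forest uv root_of_cong by simp
  have up: "(adjacent (\<Phi> n F))\<^sup>*\<^sup>* (root_of (\<Phi> n F) w) w" for w
    using forest.root_of_top(2) [of w]
    by (rule rtranclp_mono [THEN predicate2D, rotated]) (simp add: forest.adjacent_iff predicate2I)
  have "(adjacent (\<Phi> n F))\<^sup>*\<^sup>* u (root_of (\<Phi> n F) u)"
    using up adjacent_sym by (metis sympD sympI symp_rtranclp)
  then have "(adjacent (\<Phi> n F))\<^sup>*\<^sup>* u v"
    using up [of v] same by (metis rtranclp_trans)
  then obtain p where p: "graph_path (\<Phi> n F) p" "hd p = u" "last p = v"
    using path_exists by blast
  have "graph_path F p"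
    using p(1) search_forest_subset unfolding graph_path_def
    by (auto simp: adjacent_def intro: successively_mono)
  moreover have "length p \<ge> 3"
  proof (rule ccontr)
    assume "\<not> length p \<ge> 3"
    then consider x where "p = [x]" | x y where "p = [x, y]"
      using p(1) by (cases p; cases "tl p"; cases "tl (tl p)") (auto simp: graph_path_def)
    then show False
      using p uv(4) adj(2) by cases (auto simp: graph_path_def)
  qed
  moreover have "adjacent F (last p) (hd p)"
    using p adj adjacent_sym by blast
  ultimately show False
    using F by (auto simp: labeled_forests_def graph_cycle_def)
qed

lemmas order_eq = nfs_order_eq [unfolded search_forest_fixed]
lemmas child_canes = event_canes [unfolded search_forest_fixed]
lemmas stack_eq = stack_canes [unfolded search_forest_fixed]
lemmas end_iff = cane_edge_iff [unfolded search_forest_fixed]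

end

sublocale labeled_forest \<subseteq> rooted_forest n F chi "activation (all_events n F)"
  using forest.rooted_forest_axioms unfolding search_forest_fixed .

context labeled_forest
begin

lemma event_exists: "v \<in> V \<Longrightarrow> \<exists>ws ps. (v, ws, ps) \<in> set (all_events n F)"
  using actives_all by (metis (no_types, lifting) imageE list.set_map prod.collapse)

lemma end_V:
  assumes "u \<in> cane_ends F w"
  shows "u \<in> V" "w \<in> V" "component F u = component F w" "activation (all_events n F) w < activation (all_events n F) u"
proof -
  obtain ws ps where e: "(w, ws, ps) \<in> set (all_events n F)" "u \<in> set ps"
    using assms end_iff by blast
  then obtain r where r: "r \<in> set (roots n F)" "(w, ws, ps) \<in> set (search_events F r)"
    using all_events_iff by blast
  have w: "w \<in> component F r"
    using r(2) actives_component [of r] by force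
  have u: "u \<in> component F r"
    using wf_events_later [OF search_wf(1) r(2)] e(2) actives_component [of r] by blast
  have "r \<in> V"
    using root_of_root r(1) by blast
  then show "u \<in> V" "w \<in> V"
    using component_V u w by blast+
  show "component F u = component F w"
    using component_cong [OF u] component_cong [OF w] by simp
  show "activation (all_events n F) w < activation (all_events n F) u"
    using activation_less [OF all_events_wf e(1)] e(2) by simp
qed

section \<open>Edges that may be added without changing the search\<close>

definition cane_edges :: edges where
  "cane_edges = {{w, u} | w u. u \<in> cane_ends F w}"

lemma cane_edges_subset: "cane_edges \<subseteq> {{u, v} | u v. u \<in> V \<and> v \<in> V \<and> u \<noteq> v}"
proof
  fix E assume "E \<in> cane_edges"
  then obtain w u where "E = {w, u}" and u: "u \<in> cane_ends F w"
    unfolding cane_edges_def by blast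
  moreover have "w \<noteq> u"
    using end_V(4) [OF u] by auto
  ultimately show "E \<in> {{u, v} | u v. u \<in> V \<and> v \<in> V \<and> u \<noteq> v}"
    using end_V(1,2) [OF u] by blast
qed

lemma finite_cane_edges: "finite cane_edges"
proof (rule finite_subset)
  show "cane_edges \<subseteq> Pow V"
    using cane_edges_subset by blast
qed simp

lemma cane_edges_disjoint: "F \<inter> cane_edges = {}"
proof -
  have False if u: "u \<in> cane_ends F w" and E: "{w, u} \<in> F" for w u
  proof -
    have "chi w u \<or> chi u w"
      using E adjacent_iff by (simp add: adjacent_def)
    then have chi: "chi w u"
      using end_V(4) [OF u] chi_rank [of u w] by auto
    obtain ws ps where e: "(w, ws, ps) \<in> set (all_events n F)" "u \<in> set ps"
      using u end_iff by blast
    then show False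
      using chi discovers_event [OF all_events_wf e(1)] wf_events_disjoint [OF all_events_wf e(1)]
      by auto
  qed
  then show ?thesis
    unfolding cane_edges_def by blast
qed

lemma card_cane_edges: "card cane_edges = \<alpha> F"
proof -
  have fin: "finite (cane_ends F v)" for v
    by (rule finite_subset [of _ V]) (use end_V in auto)
  \<comment> \<open>Paths are counted by the length of the stack, ends by its set of entries, and
    the stack is free of repetitions.\<close>
  have count: "cane_paths_from F v = card (cane_ends F v)" if "v \<in> V" for v
  proof -
    obtain ws ps where e: "(v, ws, ps) \<in> set (all_events n F)"
      using event_exists \<open>v \<in> V\<close> by blast
    then show ?thesis
      using stack_eq [OF e] wf_events_disjoint [OF all_events_wf e] by (simp add: distinct_card)
  qed
  have "cane_edges = (\<lambda>(w, u). {w, u}) ` Sigma V (cane_ends F)"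
    unfolding cane_edges_def using end_V(2) by auto
  \<comment> \<open>The start of a cane path becomes active before its end, so an edge determines
    which end is which.\<close>
  moreover have "inj_on (\<lambda>(w, u). {w, u}) (Sigma V (cane_ends F))"
  proof (rule inj_onI, clarify)
    fix w u w' u' assume "u \<in> cane_ends F w" "u' \<in> cane_ends F w'" "{w, u} = {w', u'}"
    then show "w = w' \<and> u = u'"
      using end_V(4) [of u w] end_V(4) [of u' w'] by (auto simp: doubleton_eq_iff)
  qed
  ultimately have "card cane_edges = (\<Sum>v\<in>V. card (cane_ends F v))"
    using fin by (simp add: card_image)
  then show ?thesis
    using count by (simp add: cane_paths_eq)
qed

text \<open>When \<open>a\<close> is active, an added edge leads either to a node waiting on the
  stack or to a node below which \<open>a\<close> was waiting, hence to one active earlier. Both are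
  visited already, so the lists of new nodes do not change.\<close>

lemma search_supergraph:
  assumes "K \<subseteq> cane_edges"
  shows "F \<union> K \<in> labeled_graphs n" "\<Phi> n (F \<union> K) = F"
proof -
  define H where "H = F \<union> K"
  have "F \<subseteq> {{u, v} | u v. u \<in> V \<and> v \<in> V \<and> u \<noteq> v}"
    using G unfolding labeled_graphs_def by (rule PowD)
  then show "F \<union> K \<in> labeled_graphs n"
    unfolding labeled_graphs_def using order_trans [OF assms cane_edges_subset] by (intro PowI Un_least)
  then interpret H: labeled_graph n H
    by unfold_locales (simp add: H_def)
  have adjF: "adjacent F a w \<Longrightarrow> adjacent H a w" for a w
    by (simp add: adjacent_def H_def)
  have adjH: "adjacent F a w \<or> w \<in> cane_ends F a \<or> a \<in> cane_ends F w" if "adjacent H a w" for a w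
  proof (cases "{a, w} \<in> F")
    case False
    then have "{a, w} \<in> cane_edges"
      using that assms by (auto simp: adjacent_def H_def)
    then obtain x y where "{a, w} = {x, y}" "y \<in> cane_ends F x"
      unfolding cane_edges_def by blast
    then show ?thesis
      by (auto simp: doubleton_eq_iff)
  qed (simp add: adjacent_def)
  have sameV: "component F w = component F a" if "adjacent H a w" for a w
    using adjH [OF that]
  proof (elim disjE)
    assume "adjacent F a w"
    then show ?thesis
      by (intro component_cong) (simp add: component_def r_into_rtranclp)
  next
    assume "w \<in> cane_ends F a"
    then show ?thesis by (rule end_V(3))
  next
    assume "a \<in> cane_ends F w"
    then show ?thesis by (rule end_V(3) [symmetric])
  qed
  have comp: "component H v = component F v" for v
  proof (intro subset_antisym subsetI)
    fix u assume "u \<in> component H v"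
    then have "(adjacent H)\<^sup>*\<^sup>* v u" by (simp add: component_def)
    then have "component F u = component F v"
      by (induction rule: rtranclp_induct) (simp_all add: sameV)
    then show "u \<in> component F v"
      by (auto simp: component_def)
  next
    fix u assume "u \<in> component F v"
    then have "(adjacent F)\<^sup>*\<^sup>* v u" by (simp add: component_def)
    then have "(adjacent H)\<^sup>*\<^sup>* v u"
      by (rule rtranclp_mono [THEN predicate2D, rotated]) (simp add: adjF predicate2I)
    then show "u \<in> component H v" by (simp add: component_def)
  qed
  have roots: "roots n H = roots n F"
    by (simp add: roots_def root_of_def comp)
  have run: "nfs_run (unvisited_neighbours H) vis pend ev"
    if "nfs_run (unvisited_neighbours F) vis pend ev" "wf_events ev" "set ev \<subseteq> set (all_events n F)"
      "set pend \<subseteq> set vis" "set pend \<subseteq> component F r" "component F r \<subseteq> set vis \<union> set (map fst ev)"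
    for vis pend ev r
    using that
  proof (induction rule: nfs_run.induct)
    case (Cons vis ws ps ev a)
    have e: "(a, ws, ps) \<in> set (all_events n F)"
      using Cons.prems(2) by simp
    have "w \<in> set vis" if w: "w \<in> cane_ends F a \<or> a \<in> cane_ends F w" "adjacent H a w" for w
    proof (cases "w \<in> cane_ends F a")
      case True
      then show ?thesis
        using stack_eq [OF e] Cons.prems(3) by auto
    next
      case False
      show ?thesis
      proof (rule ccontr)
        \<comment> \<open>An unvisited \<open>w\<close> would become active later with
          \<open>a\<close> waiting below it. But \<open>a\<close> is active now and never
          again.\<close>
        assume "w \<notin> set vis"
        have "w \<in> component F w" by (simp add: component_def)
        then have "w \<in> component F r"
          using sameV [OF w(2)] component_cong [of a r] Cons.prems(4) by auto
        then have "w \<in> set (map fst ev)"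
          using Cons.prems(3,5) \<open>w \<notin> set vis\<close> by auto
        then obtain us qs where e': "(w, us, qs) \<in> set ev"
          by auto
        then have "a \<in> set qs"
          using False w(1) stack_eq Cons.prems(2) by auto
        moreover have "wf_events ev" "a \<notin> set (map fst ev)"
          using Cons.prems(1) by auto
        ultimately show False
          using wf_events_later e' by blast
      qed
    qed
    then have "{w. adjacent H a w} - set vis = {w. adjacent F a w} - set vis"
      using adjF adjH by blast
    then have ws: "ws = unvisited_neighbours H a vis"
      unfolding Cons.hyps(2) unvisited_neighbours_def by simp
    have "set ws \<subseteq> component F r"
      using new_nodes(1) [of a vis] component_closed [of a r] Cons.prems(4) Cons.hyps(2) by auto
    then have "nfs_run (unvisited_neighbours H) (vis @ ws) (rev ws @ ps) ev"
      using Cons.prems by (intro Cons.IH) auto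
    then show ?case
      using ws by (rule nfs_run.Cons)
  qed (rule nfs_run.Nil)
  have comp_run: "nfs_component (unvisited_neighbours H) r = nfs_component (unvisited_neighbours F) r"
    if "r \<in> set (roots n F)" for r
  proof -
    have "nfs_run (unvisited_neighbours H) [r] [r] (search_events F r)"
    proof (rule run [OF search_run search_wf(1)])
      show "set (search_events F r) \<subseteq> set (all_events n F)"
        using that all_events_iff by blast
      show "component F r \<subseteq> set [r] \<union> set (map fst (search_events F r))"
        using actives_component [of r] by auto
    qed (simp_all add: component_def)
    then show ?thesis
      using nfs_component_eq [OF search_run [of r]] by (simp add: nfs_component_eq)
  qed
  have "\<Phi> n H = \<Phi> n F"
    unfolding search_forest_def roots by (rule SUP_cong) (simp_all only: comp_run)
  then show "\<Phi> n (F \<union> K) = F"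
    by (simp only: search_forest_fixed H_def)
qed

lemma fiber_eq: "{G \<in> labeled_graphs n. \<Phi> n G = F} = (\<union>) F ` Pow cane_edges"
proof (intro subset_antisym subsetI)
  fix H assume "H \<in> {G \<in> labeled_graphs n. \<Phi> n G = F}"
  then have H: "H \<in> labeled_graphs n" "\<Phi> n H = F" by auto
  then interpret H: labeled_graph n H by unfold_locales
  have "F \<subseteq> H" "H \<subseteq> F \<union> cane_edges"
    using H.search_forest_subset H.graph_subset unfolding H(2) cane_edges_def by auto
  then show "H \<in> (\<union>) F ` Pow cane_edges"
    by (intro image_eqI [of _ _ "H - F"]) auto
qed (use search_supergraph in auto)

lemma finite_F: "finite F"
proof (rule finite_subset)
  show "F \<subseteq> Pow V"
    using G by (auto simp: labeled_graphs_def)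
qed simp

lemma sum_fiber:
  fixes t :: real
  shows "(\<Sum>G\<in>{G \<in> labeled_graphs n. \<Phi> n G = F}. t ^ card G) = t ^ card F * (1 + t) ^ \<alpha> F"
proof -
  have "inj_on ((\<union>) F) (Pow cane_edges)"
    using cane_edges_disjoint by (intro inj_onI) blast
  then have "(\<Sum>G\<in>{G \<in> labeled_graphs n. \<Phi> n G = F}. t ^ card G)
      = (\<Sum>K\<in>Pow cane_edges. t ^ card (F \<union> K))"
    unfolding fiber_eq by (simp add: sum.reindex)
  also have "\<dots> = (\<Sum>K\<in>Pow cane_edges. t ^ card F * t ^ card K)"
  proof (rule sum.cong)
    fix K assume "K \<in> Pow cane_edges"
    then have "card (F \<union> K) = card F + card K"
      using finite_F finite_cane_edges cane_edges_disjoint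
      by (intro card_Un_disjoint) (auto intro: finite_subset)
    then show "t ^ card (F \<union> K) = t ^ card F * t ^ card K"
      by (simp add: power_add)
  qed simp
  also have "\<dots> = t ^ card F * (1 + t) ^ \<alpha> F"
    by (simp add: sum_distrib_left [symmetric] sum_Pow_power_card finite_cane_edges card_cane_edges)
  finally show ?thesis .
qed

end

section \<open>The search order of a forest\<close>

lemma distinct_discovered: "wf_events ev \<Longrightarrow> distinct (discovered ev)"
  by (induction ev rule: wf_events.induct) auto

text \<open>Elements of \<open>R\<close> occur only as heads of blocks, so cutting at the next
  element of \<open>R\<close> recovers a block from the concatenation.\<close>

lemma concat_blocks_inj:
  assumes "concat (map (\<lambda>r. r # f r) rs) = concat (map (\<lambda>r. r # g r) rs)"
    and "set rs \<subseteq> R" "\<And>r. r \<in> set rs \<Longrightarrow> set (f r) \<inter> R = {} \<and> set (g r) \<inter> R = {}"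
    and "r \<in> set rs"
  shows "f r = g r"
  using assms
proof (induction rs)
  case (Cons q rs)
  let ?X = "concat (map (\<lambda>r. r # f r) rs)" and ?Y = "concat (map (\<lambda>r. r # g r) rs)"
  have eq: "f q @ ?X = g q @ ?Y"
    using Cons.prems(1) by simp
  have take: "takeWhile (\<lambda>x. x \<notin> R) (h q @ concat (map (\<lambda>r. r # h r) rs)) = h q"
    if "set (h q) \<inter> R = {}" for h :: "'a \<Rightarrow> 'a list"
  proof -
    have "\<And>x. x \<in> set (h q) \<Longrightarrow> x \<notin> R"
      using that by blast
    then have "takeWhile (\<lambda>x. x \<notin> R) (h q @ concat (map (\<lambda>r. r # h r) rs))
        = h q @ takeWhile (\<lambda>x. x \<notin> R) (concat (map (\<lambda>r. r # h r) rs))"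
      by (rule takeWhile_append2)
    then show ?thesis
      using Cons.prems(2) by (cases rs) auto
  qed
  have "f q = g q"
    using take [of f] take [of g] Cons.prems(3) eq by (metis list.set_intros(1))
  moreover from this have "?X = ?Y"
    using eq by simp
  ultimately show ?case
    using Cons.IH Cons.prems by auto
qed simp

text \<open>From one node to the next in the search order the stack grows by at most one, and between
  nonroots it grows only when the two nodes are siblings.\<close>

definition nfs_next :: "edges \<Rightarrow> nat \<Rightarrow> nat \<Rightarrow> bool" where
  "nfs_next F v w \<longleftrightarrow>
    (if root_of F w = w then w < root_of F v
     else root_of F w = root_of F v \<and>
       (if root_of F v = v then cane_paths_from F w = 0
        else cane_paths_from F w \<le> cane_paths_from F v \<or>
          cane_paths_from F w = Suc (cane_paths_from F v) \<and> w < v))"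

context labeled_forest
begin

definition block :: "nat \<Rightarrow> nat list" where
  "block r = r # discovered (search_events F r)"

lemma order_blocks: "nfs_order n F = concat (map block (roots n F))"
  unfolding order_eq block_def ..

lemma block_component: "set (block r) = component F r" "distinct (block r)"
  using search_wf [of r] actives_component [of r] distinct_discovered [OF search_wf(1)]
  by (auto simp: block_def)

lemma root_block: "r \<in> set (roots n F) \<Longrightarrow> v \<in> set (block r) \<Longrightarrow> root_of F v = r"
  using root_of_cong root_of_root block_component by metis

lemma set_order: "set (nfs_order n F) = V"
  unfolding order_blocks using component_exists component_V root_of_root
  by (auto simp: block_component)

lemma distinct_order: "distinct (nfs_order n F)"
proof -
  have "distinct (concat (map block rs))" if "distinct rs" "set rs \<subseteq> set (roots n F)" for rs
    using that
  proof (induction rs)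
    case (Cons r rs)
    have "set (block r) \<inter> set (block q) = {}" if "q \<in> set rs" for q
    proof -
      have "q \<noteq> r" "q \<in> set (roots n F)" "r \<in> set (roots n F)"
        using Cons.prems that by auto
      then show ?thesis
        by (metis disjoint_iff root_block)
    qed
    then show ?case
      using Cons by (auto simp: block_component(2))
  qed simp
  then show ?thesis
    unfolding order_blocks using distinct_roots by blast
qed

lemma length_order: "length (nfs_order n F) = n + 1"
  using distinct_card [OF distinct_order] by (simp add: set_order)

lemma root_of_max: "root_of F (n + 1) = n + 1"
  using root_of_ge [of "n + 1"] root_of_in [of "n + 1"] by simp

text \<open>Position 0 carries the constant coordinate 1, so this is why the node coordinate of the
  largest label is always \<open>t\<close>.\<close>

lemma hd_order: "nfs_order n F ! 0 = n + 1"
proof -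
  have max: "n + 1 \<in> set (roots n F)"
    unfolding set_roots using root_of_max by (metis atLeastAtMost_iff imageI le_add2 order_refl)
  then obtain r rs where rs: "roots n F = r # rs"
    by (cases "roots n F") auto
  have "r = n + 1"
    using max distinct_roots(2) root_of_root [of r] by (auto simp: rs)
  then show ?thesis
    unfolding order_blocks rs by (simp add: block_def)
qed

lemma discovered_not_root:
  assumes "r \<in> set (roots n F)" "v \<in> set (discovered (search_events F r))"
  shows "root_of F v \<noteq> v" "v \<notin> set (roots n F)"
proof -
  have "root_of F v = r" "v \<noteq> r"
    using root_block [OF assms(1), of v] assms(2) search_wf(3) [of r] by (auto simp: block_def)
  then show "root_of F v \<noteq> v" "v \<notin> set (roots n F)"
    using root_of_root by auto
qed

lemma annotated_search:
  assumes "r \<in> set (roots n F)"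
  shows "annotated (search_events F r)
    = map (\<lambda>v. (v, cane_paths_from F v)) (discovered (search_events F r))"
proof (rule annotated_eq_map)
  fix a ws ps i assume e: "(a, ws, ps) \<in> set (search_events F r)" and i: "i < length ws"
  then have e': "(a, ws, ps) \<in> set (all_events n F)"
    using assms all_events_iff by blast
  have "cane_paths_from F (ws ! i) = i + cane_paths_from F a"
    using child_canes [OF e' i] by simp
  then show "cane_paths_from F (ws ! i) = length ps + i"
    using stack_eq [OF e'] by simp
qed

lemma successively_block:
  assumes r: "r \<in> set (roots n F)"
  shows "successively (nfs_next F) (block r)"
proof -
  let ?d = "discovered (search_events F r)"
  have nonroot: "root_of F v = r" "root_of F v \<noteq> v" if "v \<in> set ?d" for v
    using root_block [OF r, of v] discovered_not_root(1) [OF r that] that by (auto simp: block_def)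
  have root: "root_of F r = r"
    using root_of_root [OF r] by simp
  have "successively (\<lambda>(v, j) (w, k). k \<le> j \<or> k = Suc j \<and> w < v) (annotated (search_events F r))"
    by (rule annotated_successively [OF search_run]) (use event_sorted r all_events_iff in blast)
  then have "successively (\<lambda>v w. cane_paths_from F w \<le> cane_paths_from F v \<or>
      cane_paths_from F w = Suc (cane_paths_from F v) \<and> w < v) ?d"
    unfolding annotated_search [OF r] successively_map by simp
  then have d: "successively (nfs_next F) ?d"
    by (rule successively_mono) (auto simp: nfs_next_def nonroot search_wf(3))
  show ?thesis
  proof (cases ?d)
    case (Cons v vs)
    then have "annotated (search_events F r) = (v, cane_paths_from F v) # map (\<lambda>v. (v, cane_paths_from F v)) vs"
      unfolding annotated_search [OF r] by simp
    \<comment> \<open>The search starts with a stack of size one, and \<open>annotated_hd\<close>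
      gives a strict bound.\<close>
    then have "cane_paths_from F v = 0"
      using annotated_hd [OF search_run] by fastforce
    then have "nfs_next F r v"
      using nonroot [of v] Cons root by (simp add: nfs_next_def)
    then show ?thesis
      using d by (simp add: block_def Cons)
  qed (simp add: block_def)
qed

lemma successively_order: "successively (nfs_next F) (nfs_order n F)"
proof -
  have "successively (nfs_next F) (concat (map block rs))"
    if "sorted_wrt (>) rs" "set rs \<subseteq> set (roots n F)" for rs
    using that
  proof (induction rs)
    case (Cons r rs)
    have "nfs_next F (last (block r)) (hd (concat (map block rs)))" if ne: "rs \<noteq> []"
    proof -
      obtain q qs where rs: "rs = q # qs"
        using ne by (cases rs) auto
      have "root_of F (last (block r)) = r"
        using Cons.prems by (intro root_block) (auto simp: block_def)
      moreover have "root_of F q = q" "q < r"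
        using Cons.prems root_of_root by (auto simp: rs)
      ultimately show ?thesis
        by (simp add: rs nfs_next_def) (simp add: block_def)
    qed
    moreover have "successively (nfs_next F) (concat (map block rs))" "successively (nfs_next F) (block r)"
      using Cons successively_block by auto
    ultimately show ?case
      by (cases "rs = []") (simp_all add: successively_append_iff)
  qed simp
  then show ?thesis
    unfolding order_blocks using distinct_roots(2) by blast
qed

lemma roots_eq: "set (roots n F) = {v \<in> V. root_of F v = v}"
proof (intro subset_antisym subsetI)
  fix v assume "v \<in> set (roots n F)"
  then show "v \<in> {v \<in> V. root_of F v = v}"
    using root_of_root [of v] by blast
next
  fix v assume "v \<in> {v \<in> V. root_of F v = v}"
  then show "v \<in> set (roots n F)"
    unfolding set_roots by (metis (mono_tags) image_eqI mem_Collect_eq)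
qed

end

text \<open>The stack sizes recorded by the cane path counts let one replay the search.\<close>

lemma forest_determined:
  assumes F: "F \<in> labeled_forests n" and F': "F' \<in> labeled_forests n"
    and order: "nfs_order n F = nfs_order n F'"
    and root: "\<And>v. v \<in> {1..n+1} \<Longrightarrow> root_of F v = v \<longleftrightarrow> root_of F' v = v"
    and canes: "\<And>v. v \<in> {1..n+1} \<Longrightarrow> root_of F v \<noteq> v \<Longrightarrow> cane_paths_from F v = cane_paths_from F' v"
  shows "F = F'"
proof -
  interpret F: labeled_forest n F by (rule labeled_forest.intro [OF F])
  interpret F': labeled_forest n F' by (rule labeled_forest.intro [OF F'])
  have "set (roots n F) = set (roots n F')"
    unfolding F.roots_eq F'.roots_eq using root by auto
  then have roots: "roots n F = roots n F'"
    unfolding F.set_roots F'.set_roots by (simp add: roots_def)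
  have events: "search_events F r = search_events F' r" if r: "r \<in> set (roots n F)" for r
  proof -
    have "discovered (search_events F r) = discovered (search_events F' r)"
    proof (rule concat_blocks_inj [where f = "\<lambda>r. discovered (search_events F r)"
          and g = "\<lambda>r. discovered (search_events F' r)", OF _ subset_refl _ r])
      show "concat (map (\<lambda>r. r # discovered (search_events F r)) (roots n F))
          = concat (map (\<lambda>r. r # discovered (search_events F' r)) (roots n F))"
        using order by (simp only: F.order_eq F'.order_eq roots)
      show "set (discovered (search_events F q)) \<inter> set (roots n F) = {} \<and>
          set (discovered (search_events F' q)) \<inter> set (roots n F) = {}"
        if "q \<in> set (roots n F)" for q
      proof -
        have q: "q \<in> set (roots n F')" using that roots by simp
        show ?thesis
          using F.discovered_not_root(2) [OF that] F'.discovered_not_root(2) [OF q] roots by auto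
      qed
    qed
    moreover have "cane_paths_from F v = cane_paths_from F' v"
      if v: "v \<in> set (discovered (search_events F r))" for v
    proof (rule canes)
      have "v \<in> component F r"
        using v F.block_component(1) [of r] by (auto simp: F.block_def)
      then show "v \<in> {1..n+1}"
        using F.component_V [of r] F.root_of_root [OF r] by blast
      show "root_of F v \<noteq> v"
        using F.discovered_not_root(1) r v .
    qed
    ultimately have "annotated (search_events F r) = annotated (search_events F' r)"
      using F.annotated_search [OF r] F'.annotated_search [of r] r roots by (simp cong: map_cong)
    then show ?thesis
      using annotated_inj [OF F.search_run F'.search_run] by blast
  qed
  then have "all_events n F = all_events n F'"
    unfolding all_events_def roots [symmetric] by (simp cong: map_cong)
  then have "\<Phi> n F = \<Phi> n F'"
    unfolding F.search_forest_eq F'.search_forest_eq by simp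
  then show ?thesis
    by (simp only: F.search_forest_fixed F'.search_forest_fixed)
qed

section \<open>The simplex of a forest\<close>

text \<open>Serves to read off the number of cane paths from the coordinates of a node and of its
  root.\<close>

lemma power_bracket_unique:
  fixes x y s :: real
  assumes "s > 1" "x > 0" "s ^ j * x < y" "y < s ^ Suc j * x" "s ^ k * x < y" "y < s ^ Suc k * x"
  shows "j = k"
proof -
  have "b \<le> a" if "s ^ b * x < y" "y < s ^ Suc a * x" for a b
  proof (rule ccontr)
    assume "\<not> b \<le> a"
    then have "s ^ Suc a \<le> s ^ b"
      using assms(1) by (intro power_increasing) auto
    then have "s ^ Suc a * x \<le> s ^ b * x"
      using assms(2) by (intro mult_right_mono) auto
    with that show False by linarith
  qed
  with assms show ?thesis by (meson le_antisym)
qed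

locale forest_polytope = labeled_forest n F for n :: nat and F :: edges +
  fixes t :: real and e :: "nat \<Rightarrow> 'n::finite"
  assumes n: "n \<ge> 1" and t: "t > 0" and e: "bij_betw e {1..n} (UNIV :: 'n set)"
begin

abbreviation pos :: "nat \<Rightarrow> nat" where "pos \<equiv> nfs_position n F"
abbreviation node :: "nat \<Rightarrow> nat" where "node p \<equiv> nfs_order n F ! p"
abbreviation c :: "real ^ 'n \<Rightarrow> nat \<Rightarrow> real" where "c x \<equiv> node_coord n e F t x"

lemma node_V: "p \<le> n \<Longrightarrow> node p \<in> V"
  using set_order length_order nth_mem [of p "nfs_order n F"] by simp

lemma pos_node: "p \<le> n \<Longrightarrow> pos (node p) = p"
  unfolding nfs_position_def using distinct_order length_order
  by (intro the_equality) (auto simp: nth_eq_iff_index_eq)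

lemma node_exists: "v \<in> V \<Longrightarrow> \<exists>p\<le>n. v = node p"
  using set_order length_order by (metis Suc_eq_plus1 in_set_conv_nth less_Suc_eq_le)

lemma pos_le: "v \<in> V \<Longrightarrow> pos v \<le> n" and node_pos: "v \<in> V \<Longrightarrow> node (pos v) = v"
  using node_exists pos_node by force+

text \<open>The coordinates of a point are indexed by position, while the defining chain of the
  simplex runs over labels. This and the next two notions express the forest by position.\<close>

definition root_pos :: "nat \<Rightarrow> nat" where
  "root_pos p = pos (root_of F (node p))"

definition is_root :: "nat \<Rightarrow> bool" where
  "is_root p \<longleftrightarrow> root_of F (node p) = node p"

definition canes_at :: "nat \<Rightarrow> nat" where
  "canes_at p = cane_paths_from F (node p)"

lemma node_root_pos: "p \<le> n \<Longrightarrow> node (root_pos p) = root_of F (node p)"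
  unfolding root_pos_def using node_pos root_of_in node_V by blast

lemma root_pos_le_n: "p \<le> n \<Longrightarrow> root_pos p \<le> n"
  unfolding root_pos_def using pos_le root_of_in node_V by blast

lemma root_pos_root: "p \<le> n \<Longrightarrow> is_root p \<Longrightarrow> root_pos p = p"
  by (simp add: is_root_def root_pos_def pos_node)

lemma is_root_root_pos: "p \<le> n \<Longrightarrow> is_root (root_pos p)"
  by (simp add: is_root_def node_root_pos root_of_root_of)

lemma is_root_0: "is_root 0"
  using root_of_max by (simp add: is_root_def hd_order)

lemma c_node:
  assumes "p \<le> n"
  shows "c x (node p) = (if is_root p then t * coord e x p
    else coord e x p / (1 + t) ^ canes_at p - coord e x (root_pos p))"
  using assms by (auto simp: node_coord_def Let_def is_root_def root_pos_def canes_at_def pos_node)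

lemma next_node:
  assumes "Suc p \<le> n"
  shows "nfs_next F (node p) (node (Suc p))"
  using successively_order assms unfolding successively_conv_nth length_order by simp

lemma next_root:
  assumes "Suc p \<le> n" "is_root (Suc p)"
  shows "node (Suc p) < node (root_pos p)"
  using next_node [OF assms(1)] assms by (simp add: nfs_next_def is_root_def node_root_pos)

lemma next_nonroot:
  assumes "Suc p \<le> n" "\<not> is_root (Suc p)"
  shows "root_pos (Suc p) = root_pos p"
    and "if is_root p then canes_at (Suc p) = 0
      else canes_at (Suc p) \<le> canes_at p \<or>
        canes_at (Suc p) = Suc (canes_at p) \<and> node (Suc p) < node p"
  using next_node [OF assms(1)] assms
  by (auto simp: nfs_next_def is_root_def root_pos_def canes_at_def split: if_splits)

lemma root_pos_le: "p \<le> n \<Longrightarrow> root_pos p \<le> p"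
proof (induction p)
  case 0
  then show ?case using root_pos_root is_root_0 by simp
next
  case (Suc p)
  then show ?case
    using root_pos_root [of "Suc p"] next_nonroot(1) [of p] by (cases "is_root (Suc p)") auto
qed

lemma root_pos_less:
  assumes "p \<le> n" "\<not> is_root p"
  shows "root_pos p < p"
  using root_pos_le [OF assms(1)] is_root_root_pos [OF assms(1)] assms(2) by (metis le_neq_implies_less)

lemma c_max: "c x (n + 1) = t"
  using c_node [of 0 x] is_root_0 by (simp add: hd_order coord_def)

lemma root_of_node_gt:
  assumes "p \<le> n" "\<not> is_root p"
  shows "node p < node (root_pos p)"
  using root_of_ge [of "node p"] assms by (auto simp: is_root_def node_root_pos)

section \<open>The simplex lies in the polytope\<close>

lemma mono_c:
  assumes "x \<in> forest_simplex n e t F" "u \<in> V" "v \<in> V" "u \<le> v"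
  shows "c x u \<le> c x v" "0 \<le> c x u"
proof -
  have step: "c x k \<le> c x (Suc k)" if "1 \<le> k" "k < n + 1" for k
    using assms(1) that by (simp add: forest_simplex_def)
  have mono: "c x u \<le> c x v" if "1 \<le> u" "u \<le> v" "v \<le> n + 1" for u v
    using that(2,1,3)
  proof (induction rule: dec_induct)
    case (step k)
    then show ?case using \<open>\<And>k. 1 \<le> k \<Longrightarrow> k < n + 1 \<Longrightarrow> c x k \<le> c x (Suc k)\<close> [of k] by simp
  qed simp
  show "c x u \<le> c x v" using mono assms by auto
  have "0 \<le> c x 1" using assms(1) by (simp add: forest_simplex_def)
  also have "c x 1 \<le> c x u" using mono assms(2) by auto
  finally show "0 \<le> c x u" .
qed

lemma coord_bounds:
  assumes x: "x \<in> forest_simplex n e t F" and p: "p \<le> n"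
  shows "is_root p \<Longrightarrow> 0 \<le> coord e x p"
    and "\<not> is_root p \<Longrightarrow> (1 + t) ^ canes_at p * coord e x (root_pos p) \<le> coord e x p"
    and "\<not> is_root p \<Longrightarrow> coord e x p \<le> (1 + t) ^ Suc (canes_at p) * coord e x (root_pos p)"
proof -
  have c0: "0 \<le> c x (node p)"
    using mono_c(2) [OF x node_V [OF p] node_V [OF p]] by simp
  show "0 \<le> coord e x p" if "is_root p"
    using c0 c_node [OF p] that t by (simp add: zero_le_mult_iff)
  have pow: "(1 + t) ^ canes_at p > 0" using t by simp
  show "(1 + t) ^ canes_at p * coord e x (root_pos p) \<le> coord e x p" if "\<not> is_root p"
    using c0 c_node [OF p] that pow by (simp add: field_simps)
  show "coord e x p \<le> (1 + t) ^ Suc (canes_at p) * coord e x (root_pos p)" if nr: "\<not> is_root p"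
  proof -
    \<comment> \<open>The root has the largest label of its component; its node coordinate,
      \<open>t\<close> times its coordinate, supplies the upper bound.\<close>
    have "c x (node p) \<le> c x (node (root_pos p))"
      using mono_c(1) [OF x node_V [OF p] node_V [OF root_pos_le_n [OF p]]] root_of_node_gt [OF p nr] by simp
    also have "\<dots> = t * coord e x (root_pos p)"
      using c_node [OF root_pos_le_n [OF p]] is_root_root_pos [OF p] by simp
    finally have "coord e x p / (1 + t) ^ canes_at p \<le> (1 + t) * coord e x (root_pos p)"
      using c_node [OF p] nr by (simp add: algebra_simps)
    then show ?thesis
      using pow by (simp add: pos_divide_le_eq ac_simps)
  qed
qed

lemma coord_nonneg:
  assumes "x \<in> forest_simplex n e t F" "p \<le> n"
  shows "0 \<le> coord e x (root_pos p)" "coord e x (root_pos p) \<le> coord e x p"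
proof -
  show root: "0 \<le> coord e x (root_pos p)"
    using coord_bounds(1) [OF assms(1) root_pos_le_n [OF assms(2)]] is_root_root_pos [OF assms(2)] .
  show "coord e x (root_pos p) \<le> coord e x p"
  proof (cases "is_root p")
    case False
    have "1 * coord e x (root_pos p) \<le> (1 + t) ^ canes_at p * coord e x (root_pos p)"
      using t root by (intro mult_right_mono one_le_power) auto
    then show ?thesis
      using coord_bounds(2) [OF assms False] by simp
  qed (simp add: root_pos_root assms)
qed

text \<open>For a new root, the decreasing labels of roots give a coordinate at most that of the
  previous root. If the stack does not grow between nonroots, the bounds of
  \<open>coord_bounds\<close> suffice. If it grows by one, they miss by a factor
  \<open>1 + t\<close>; then the two nodes are siblings with decreasing labels, and comparing their
  node coordinates saves the factor.\<close>

lemma coord_step: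
  assumes x: "x \<in> forest_simplex n e t F" and p: "Suc p \<le> n"
  shows "coord e x (Suc p) \<le> (1 + t) * coord e x p"
proof -
  have p': "p \<le> n" using p by simp
  let ?X = "coord e x" and ?l = "root_pos p"
  note nonneg = coord_nonneg [OF x p']
  have ge: "?X p \<le> (1 + t) * ?X p"
    using nonneg t by (simp add: algebra_simps)
  show ?thesis
  proof (cases "is_root (Suc p)")
    case True
    have "c x (node (Suc p)) \<le> c x (node ?l)"
      using mono_c(1) [OF x node_V [OF p] node_V [OF root_pos_le_n [OF p']]] next_root [OF p True] by simp
    then have "t * ?X (Suc p) \<le> t * ?X ?l"
      using c_node [OF p] c_node [OF root_pos_le_n [OF p']] is_root_root_pos [OF p'] True by simp
    then show ?thesis
      using t nonneg ge by simp
  next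
    case False
    note next_nr = next_nonroot [OF p False]
    have up: "?X (Suc p) \<le> (1 + t) ^ Suc (canes_at (Suc p)) * ?X ?l"
      using coord_bounds(3) [OF x p False] next_nr(1) by simp
    show ?thesis
    proof (cases "is_root p")
      case True
      then show ?thesis
        using up next_nr(2) root_pos_root [OF p' True] by simp
    next
      case nr: False
      then consider "canes_at (Suc p) \<le> canes_at p"
        | "canes_at (Suc p) = Suc (canes_at p)" "node (Suc p) < node p"
        using next_nr(2) by auto
      then show ?thesis
      proof cases
        case 1
        note up
        also have "(1 + t) ^ Suc (canes_at (Suc p)) * ?X ?l \<le> (1 + t) ^ Suc (canes_at p) * ?X ?l"
          using 1 t nonneg by (intro mult_right_mono power_increasing) auto
        also have "\<dots> = (1 + t) * ((1 + t) ^ canes_at p * ?X ?l)"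
          by simp
        also have "\<dots> \<le> (1 + t) * ?X p"
          using coord_bounds(2) [OF x p' nr] t by (intro mult_left_mono) auto
        finally show ?thesis .
      next
        case 2
        have "c x (node (Suc p)) \<le> c x (node p)"
          using mono_c(1) [OF x node_V [OF p] node_V [OF p']] 2 by simp
        then have "?X (Suc p) / (1 + t) ^ Suc (canes_at p) \<le> ?X p / (1 + t) ^ canes_at p"
          using c_node [OF p] c_node [OF p'] False nr next_nr(1) 2 by simp
        then have "?X (Suc p) \<le> (1 + t) ^ Suc (canes_at p) * (?X p / (1 + t) ^ canes_at p)"
          using t by (simp add: pos_divide_le_eq ac_simps del: power_Suc)
        also have "\<dots> = (1 + t) * ?X p"
          using t by simp
        finally show ?thesis .
      qed
    qed
  qed
qed

lemma forest_simplex_subset: "forest_simplex n e t F \<subseteq> gayley_polytope n e t"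
proof
  fix x assume x: "x \<in> forest_simplex n e t F"
  have nonneg: "0 \<le> coord e x p" if "p \<le> n" for p
    using coord_nonneg [OF x that] by linarith
  have step: "coord e x p \<le> (1 + t) * coord e x (p - 1)" if "1 \<le> p" "p \<le> n" for p
    using coord_step [OF x, of "p - 1"] that by simp
  have "coord e x 1 \<le> 1 + t"
    using step [of 1] n by (simp add: coord_def)
  then show "x \<in> gayley_polytope n e t"
    unfolding gayley_polytope_def using nonneg step n by simp
qed

section \<open>Node coordinates as an affine map, and the volume\<close>

definition node_linear :: "real ^ 'n \<Rightarrow> real ^ 'n" where
  "node_linear x = (\<chi> i. c x (inv_into {1..n} (e \<circ> pos) i) - c 0 (inv_into {1..n} (e \<circ> pos) i))"

definition node_offset :: "real ^ 'n" where
  "node_offset = (\<chi> i. c 0 (inv_into {1..n} (e \<circ> pos) i))"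

lemma node_pos_range: "p \<in> {1..n} \<Longrightarrow> node p \<in> {1..n}"
  using node_V [of p] pos_node [of p] pos_node [of 0] hd_order by (cases "node p = n + 1") auto

lemma bij_e_pos: "bij_betw (e \<circ> pos) {1..n} UNIV"
proof (rule bij_betw_trans [OF _ e])
  show "bij_betw pos {1..n} {1..n}"
  proof (rule bij_betw_byWitness [where f' = node])
    show "pos ` {1..n} \<subseteq> {1..n}"
    proof
      fix p assume "p \<in> pos ` {1..n}"
      then obtain v where v: "v \<in> {1..n}" "p = pos v" by blast
      then have "v \<in> V" by auto
      then have "pos v \<noteq> 0"
        using node_pos [of v] hd_order v(1) by (metis Suc_eq_plus1 atLeastAtMost_iff not_less_eq_eq order_refl)
      then show "p \<in> {1..n}"
        using pos_le [OF \<open>v \<in> V\<close>] v by simp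
    qed
  qed (use node_pos pos_node node_pos_range in auto)
qed

lemma inv_e_pos: "p \<in> {1..n} \<Longrightarrow> inv_into {1..n} (e \<circ> pos) (e p) = node p"
proof -
  assume p: "p \<in> {1..n}"
  then have "e p = (e \<circ> pos) (node p)"
    using pos_node by simp
  then show ?thesis
    using bij_e_pos node_pos_range [OF p] by (metis bij_betw_def inv_into_f_f)
qed

text \<open>The row with index \<open>e p\<close> belongs to the node at position \<open>p\<close>,
  which makes the matrix triangular. A component with root position 0 subtracts the constant 1,
  which has moved to \<open>node_offset\<close>; hence the 0.\<close>

lemma node_linear_e:
  assumes "p \<in> {1..n}"
  shows "node_linear x $ e p = (if is_root p then t * x $ e p
    else x $ e p / (1 + t) ^ canes_at p - (if root_pos p = 0 then 0 else x $ e (root_pos p)))"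
  unfolding node_linear_def vec_lambda_beta inv_e_pos [OF assms]
  using assms by (simp add: c_node coord_def)

lemma e_cases: obtains p where "p \<in> {1..n}" "i = e p"
  using e by (metis UNIV_I bij_betw_def imageE)

lemma linear_node_linear: "linear node_linear"
proof (rule linearI)
  fix x y
  have "node_linear (x + y) $ i = (node_linear x + node_linear y) $ i" for i
    by (rule e_cases [of i]) (auto simp: node_linear_e algebra_simps add_divide_distrib)
  then show "node_linear (x + y) = node_linear x + node_linear y"
    by (simp add: vec_eq_iff)
next
  fix r x
  have "node_linear (r *\<^sub>R x) $ i = (r *\<^sub>R node_linear x) $ i" for i
    by (rule e_cases [of i]) (auto simp: node_linear_e algebra_simps)
  then show "node_linear (r *\<^sub>R x) = r *\<^sub>R node_linear x"
    by (simp add: vec_eq_iff)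
qed

text \<open>A row involves its own position and at most the earlier position of a root. The diagonal
  has \<open>t\<close> for a root and a negative power of \<open>1 + t\<close> otherwise. Nonroots
  correspond to edges of \<open>F\<close>, and position 0 is a root, so \<open>n - card F\<close>
  roots remain among the positions from 1 to \<open>n\<close>.\<close>

lemma det_node_linear: "det (matrix node_linear) = t ^ (n - card F) / (1 + t) ^ \<alpha> F" "card F \<le> n"
proof -
  define f where "f = inv_into {1..n} e"
  have fe: "f (e p) = p" if "p \<in> {1..n}" for p
    unfolding f_def using e that by (simp add: bij_betw_def)
  have e_eq: "e p = e q \<longleftrightarrow> p = q" if "p \<in> {1..n}" "q \<in> {1..n}" for p q
    using fe that by metis
  have "det (matrix node_linear) = (\<Prod>i\<in>UNIV. matrix node_linear $ i $ i)"
  proof (rule det_triangular_rank [where f = f])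
    fix i j assume ij: "i \<noteq> j" "f i \<le> f j"
    obtain p q where p: "p \<in> {1..n}" "i = e p" and q: "q \<in> {1..n}" "j = e q"
      by (metis e_cases)
    have "p \<noteq> q" "p \<le> q" using ij p q fe by auto
    moreover have "e (root_pos p) \<noteq> e q" if "\<not> is_root p" "root_pos p \<noteq> 0"
      using e_eq [of "root_pos p" q] root_pos_less [of p] that \<open>p \<le> q\<close> p q by auto
    ultimately show "matrix node_linear $ i $ j = 0"
      using e_eq p q by (auto simp: matrix_def node_linear_e axis_def)
  qed
  also have "\<dots> = (\<Prod>p\<in>{1..n}. matrix node_linear $ e p $ e p)"
    using prod.reindex_bij_betw [OF e, of "\<lambda>i. matrix node_linear $ i $ i"] by simp
  also have "\<dots> = (\<Prod>p\<in>{1..n}. (if is_root p then t else 1) / (1 + t) ^ canes_at p)"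
  proof (rule prod.cong)
    fix p assume p: "p \<in> {1..n}"
    have "e (root_pos p) \<noteq> e p" if "\<not> is_root p" "root_pos p \<noteq> 0"
      using e_eq [of "root_pos p" p] root_pos_less [of p] that p by auto
    moreover have "canes_at p = 0" if "is_root p"
      using cane_paths_from_root root_of_self_iff that by (auto simp: canes_at_def is_root_def)
    ultimately show "matrix node_linear $ e p $ e p = (if is_root p then t else 1) / (1 + t) ^ canes_at p"
      using p by (auto simp: matrix_def node_linear_e axis_def)
  qed simp
  also have "\<dots> = t ^ card {p \<in> {1..n}. is_root p} / (1 + t) ^ (\<Sum>p\<in>{1..n}. canes_at p)"
    by (simp add: prod_dividef power_sum prod.If_cases Int_def)
  finally have det: "det (matrix node_linear)
      = t ^ card {p \<in> {1..n}. is_root p} / (1 + t) ^ (\<Sum>p\<in>{1..n}. canes_at p)" .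
  have bij: "bij_betw node {0..n} V"
    by (rule bij_betw_byWitness [where f' = pos]) (use pos_node node_pos pos_le node_V in auto)
  have "\<alpha> F = (\<Sum>p\<in>{0..n}. canes_at p)"
    unfolding cane_paths_eq canes_at_def by (rule sum.reindex_bij_betw [OF bij, symmetric])
  also have "\<dots> = canes_at 0 + (\<Sum>p\<in>{1..n}. canes_at p)"
    by (simp add: sum.atLeast_Suc_atMost)
  also have "canes_at 0 = 0"
    using cane_paths_from_root root_of_self_iff is_root_0 by (auto simp: canes_at_def is_root_def)
  finally have alpha: "\<alpha> F = (\<Sum>p\<in>{1..n}. canes_at p)" by simp
  have "{w. \<exists>a. chi a w} = node ` {p \<in> {1..n}. \<not> is_root p}"
  proof (intro subset_antisym subsetI)
    fix w assume w: "w \<in> {w. \<exists>a. chi a w}"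
    then have "w \<in> V" "root_of F w \<noteq> w"
      using chi_V root_of_self_iff by blast+
    then obtain p where "p \<le> n" "w = node p" "\<not> is_root p"
      using node_exists is_root_def by blast
    moreover from this have "p \<noteq> 0" using is_root_0 by metis
    ultimately show "w \<in> node ` {p \<in> {1..n}. \<not> is_root p}" by auto
  qed (use root_of_self_iff in \<open>auto simp: is_root_def\<close>)
  moreover have "inj_on node {p \<in> {1..n}. \<not> is_root p}"
    by (rule inj_on_subset [OF bij_betw_imp_inj_on [OF bij]]) auto
  ultimately have "card F = card {p \<in> {1..n}. \<not> is_root p}"
    by (simp add: card_F card_image)
  moreover have "card {p \<in> {1..n}. is_root p} + card {p \<in> {1..n}. \<not> is_root p} = card {1..n}"
    using card_Int_Diff [of "{1..n}" "Collect is_root"] by (simp add: Int_def set_diff_eq)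
  ultimately have "card {p \<in> {1..n}. is_root p} = n - card F" "card F \<le> n"
    by auto
  then show "det (matrix node_linear) = t ^ (n - card F) / (1 + t) ^ \<alpha> F" "card F \<le> n"
    using det alpha by simp_all
qed

lemma
  shows forest_simplex_simplex: "int n simplex forest_simplex n e t F"
    and forest_simplex_volume:
      "fact n * measure lebesgue (forest_simplex n e t F) = t ^ card F * (1 + t) ^ \<alpha> F"
    and forest_simplex_interior:
      "interior (forest_simplex n e t F) = {x. 0 < c x 1 \<and> (\<forall>k\<in>{1..n}. c x k < c x (k + 1))}"
proof -
  have y: "(node_linear x + node_offset) $ (e \<circ> pos) k = c x k" if "k \<in> {1..n}" for x k
  proof -
    have "inv_into {1..n} (e \<circ> pos) ((e \<circ> pos) k) = k"
      using bij_e_pos that by (metis bij_betw_def inv_into_f_f)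
    then show ?thesis
      by (simp add: node_linear_def node_offset_def)
  qed
  \<comment> \<open>The last link of the chain compares with label \<open>n + 1\<close>, whose node
    coordinate is \<open>t\<close>. It becomes the upper bound in
    \<open>ordered_simplex\<close>.\<close>
  have split: "{1..n} = insert n {1..<n}"
    using n by auto
  have last: "c x (Suc n) = t" for x
    using c_max by simp
  have det: "det (matrix node_linear) \<noteq> 0"
    using det_node_linear t by simp
  note * = ordered_simplex [OF linear_node_linear det n bij_e_pos t, of node_offset]
  have eq: "{x. 0 \<le> (node_linear x + node_offset) $ (e \<circ> pos) 1 \<and>
      (\<forall>k\<in>{1..<n}. (node_linear x + node_offset) $ (e \<circ> pos) k
        \<le> (node_linear x + node_offset) $ (e \<circ> pos) (k+1)) \<and>
      (node_linear x + node_offset) $ (e \<circ> pos) n \<le> t} = forest_simplex n e t F"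
    unfolding forest_simplex_def split using n last y by auto
  have eq': "{x. 0 < (node_linear x + node_offset) $ (e \<circ> pos) 1 \<and>
      (\<forall>k\<in>{1..<n}. (node_linear x + node_offset) $ (e \<circ> pos) k
        < (node_linear x + node_offset) $ (e \<circ> pos) (k+1)) \<and>
      (node_linear x + node_offset) $ (e \<circ> pos) n < t}
      = {x. 0 < c x 1 \<and> (\<forall>k\<in>{1..n}. c x k < c x (k + 1))}"
    unfolding split using n last y by auto
  show "int n simplex forest_simplex n e t F"
    using *(1) unfolding eq .
  show "interior (forest_simplex n e t F) = {x. 0 < c x 1 \<and> (\<forall>k\<in>{1..n}. c x k < c x (k + 1))}"
    using *(3) unfolding eq eq' .
  have "fact n * measure lebesgue (forest_simplex n e t F) = t ^ n / \<bar>det (matrix node_linear)\<bar>"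
    using *(2) unfolding eq .
  also have "\<dots> = t ^ n / t ^ (n - card F) * (1 + t) ^ \<alpha> F"
    using t unfolding det_node_linear(1) by simp
  also have "t ^ n / t ^ (n - card F) = t ^ card F"
    using t det_node_linear(2) by (simp add: power_diff)
  finally show "fact n * measure lebesgue (forest_simplex n e t F) = t ^ card F * (1 + t) ^ \<alpha> F" .
qed

section \<open>Recovering the forest from an interior point\<close>

lemma strict_mono_c:
  assumes "x \<in> interior (forest_simplex n e t F)" "u \<in> V"
  shows "0 < c x u" "v \<in> V \<Longrightarrow> u < v \<longleftrightarrow> c x u < c x v"
proof -
  have step: "c x k < c x (Suc k)" if "1 \<le> k" "k < n + 1" for k
    using assms(1) that unfolding forest_simplex_interior by simp
  have mono: "c x u < c x v" if "1 \<le> u" "u < v" "v \<le> n + 1" for u v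
    using that(2,1,3)
  proof (induction rule: strict_inc_induct)
    case (base k)
    then show ?case using step [of k] by simp
  next
    case (step k)
    then show ?case using \<open>\<And>k. 1 \<le> k \<Longrightarrow> k < n + 1 \<Longrightarrow> c x k < c x (Suc k)\<close> [of k] by simp
  qed
  have "0 < c x 1" using assms(1) unfolding forest_simplex_interior by simp
  then show "0 < c x u" using mono [of 1 u] assms(2) by (cases "u = 1") auto
  show "v \<in> V \<Longrightarrow> u < v \<longleftrightarrow> c x u < c x v"
    using mono [of u v] mono [of v u] assms(2) by (cases u v rule: linorder_cases) auto
qed

text \<open>Roots come with decreasing labels, hence with decreasing coordinates, whereas a nonroot
  has a larger coordinate than its root. Comparing with the current root therefore detects where a
  component begins.\<close>

lemma interior_decode:
  assumes x: "x \<in> interior (forest_simplex n e t F)"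
  shows "p \<le> n \<Longrightarrow> 0 < coord e x (root_pos p)"
    and "Suc p \<le> n \<Longrightarrow> is_root (Suc p) \<longleftrightarrow> coord e x (Suc p) < coord e x (root_pos p)"
    and "p \<le> n \<Longrightarrow> \<not> is_root p \<Longrightarrow> (1 + t) ^ canes_at p * coord e x (root_pos p) < coord e x p"
    and "p \<le> n \<Longrightarrow> \<not> is_root p \<Longrightarrow>
      coord e x p < (1 + t) ^ Suc (canes_at p) * coord e x (root_pos p)"
proof -
  let ?X = "coord e x"
  have root_c: "c x (node (root_pos p)) = t * ?X (root_pos p)" if "p \<le> n" for p
    using c_node [OF root_pos_le_n [OF that]] is_root_root_pos [OF that] by simp
  show pos: "0 < ?X (root_pos p)" if "p \<le> n" for p
    using strict_mono_c(1) [OF x node_V [OF root_pos_le_n [OF that]]] root_c [OF that] t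
    by (simp add: zero_less_mult_iff)
  have pow: "(1 + t) ^ k > 0" for k using t by simp
  show low: "(1 + t) ^ canes_at p * ?X (root_pos p) < ?X p" if "p \<le> n" "\<not> is_root p" for p
    using strict_mono_c(1) [OF x node_V [OF that(1)]] c_node [OF that(1)] that(2) pow [of "canes_at p"]
    by (simp add: field_simps)
  show "?X p < (1 + t) ^ Suc (canes_at p) * ?X (root_pos p)" if "p \<le> n" "\<not> is_root p" for p
  proof -
    have "c x (node p) < t * ?X (root_pos p)"
      using strict_mono_c(2) [OF x node_V [OF that(1)] node_V [OF root_pos_le_n [OF that(1)]]]
        root_of_node_gt [OF that] root_c [OF that(1)] by simp
    then have "?X p / (1 + t) ^ canes_at p < (1 + t) * ?X (root_pos p)"
      using c_node [OF that(1)] that(2) by (simp add: algebra_simps)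
    then show ?thesis
      using pow [of "canes_at p"] by (simp add: pos_divide_less_eq ac_simps)
  qed
  show "is_root (Suc p) \<longleftrightarrow> ?X (Suc p) < ?X (root_pos p)" if p: "Suc p \<le> n" for p
  proof (cases "is_root (Suc p)")
    case True
    have "c x (node (Suc p)) < t * ?X (root_pos p)"
      using strict_mono_c(2) [OF x node_V [OF p] node_V [OF root_pos_le_n]] next_root [OF p True] root_c [of p] p
      by simp
    then show ?thesis
      using c_node [OF p] True t by simp
  next
    case False
    have "1 * ?X (root_pos p) \<le> (1 + t) ^ canes_at (Suc p) * ?X (root_pos p)"
      using pos [of p] p t by (intro mult_right_mono one_le_power) auto
    then show ?thesis
      using low [OF p False] next_nonroot(1) [OF p False] False by simp
  qed
qed

text \<open>By \<open>c_node\<close>, a node coordinate depends on the forest only through roots and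
  cane counts by position. Once these are known, counting smaller node coordinates yields the
  labels.\<close>

lemma node_rank:
  assumes x: "x \<in> interior (forest_simplex n e t F)" and p: "p \<le> n"
  shows "node p = Suc (card {q. q \<le> n \<and> c x (node q) < c x (node p)})"
proof -
  have "c x (node q) < c x (node p) \<longleftrightarrow> node q < node p" if "q \<le> n" for q
    using strict_mono_c(2) [OF x node_V [OF that] node_V [OF p]] by simp
  then have "{q. q \<le> n \<and> c x (node q) < c x (node p)} = {q. q \<le> n \<and> node q < node p}"
    by blast
  also have "card \<dots> = card {1..<node p}"
  proof (rule bij_betw_same_card)
    show "bij_betw node {q. q \<le> n \<and> node q < node p} {1..<node p}"
    proof (rule bij_betw_byWitness [where f' = pos])
      show "pos ` {1..<node p} \<subseteq> {q. q \<le> n \<and> node q < node p}"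
        using node_V [OF p] pos_le node_pos by auto
    qed (use pos_node node_pos node_V [OF p] node_V in auto)
  qed
  finally show ?thesis
    using node_V [OF p] by simp
qed

end

section \<open>The triangulation\<close>

lemma divide_power_Suc_le_iff:
  fixes a b s :: real
  assumes "s > 0"
  shows "a / s ^ Suc m \<le> b / s ^ m \<longleftrightarrow> a \<le> s * b"
proof -
  have "a / s ^ Suc m \<le> b / s ^ m \<longleftrightarrow> a \<le> b / s ^ m * s ^ Suc m"
    using assms by (intro pos_divide_le_eq) simp
  also have "b / s ^ m * s ^ Suc m = s * b"
    using assms by simp
  finally show ?thesis .
qed

lemma forest_eq_if_interiors_meet:
  assumes "forest_polytope n F t e" "forest_polytope n F' t e"
    and x: "x \<in> interior (forest_simplex n e t F)" and x': "x \<in> interior (forest_simplex n e t F')"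
  shows "F = F'"
proof -
  interpret F: forest_polytope n F t e by (rule assms)
  interpret F': forest_polytope n F' t e by (rule assms)
  note dec = F.interior_decode [OF x] and dec' = F'.interior_decode [OF x']
  \<comment> \<open>Both claims go through one induction, because the test for a root at
    \<open>Suc p\<close> refers to the root position of \<open>p\<close>.\<close>
  have same: "(F.is_root p \<longleftrightarrow> F'.is_root p) \<and> F.root_pos p = F'.root_pos p" if "p \<le> n" for p
    using that
  proof (induction p)
    case 0
    then show ?case
      using F.is_root_0 F'.is_root_0 F.root_pos_root F'.root_pos_root by metis
  next
    case (Suc p)
    then have IH: "F.root_pos p = F'.root_pos p" by simp
    have root: "F.is_root (Suc p) \<longleftrightarrow> F'.is_root (Suc p)"
      using dec(2) [OF Suc.prems] dec'(2) [OF Suc.prems] IH by simp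
    show ?case
    proof (cases "F.is_root (Suc p)")
      case True
      then show ?thesis
        using root F.root_pos_root [OF Suc.prems] F'.root_pos_root [OF Suc.prems] by simp
    next
      case False
      then show ?thesis
        using root F.next_nonroot(1) [OF Suc.prems] F'.next_nonroot(1) [OF Suc.prems] IH by simp
    qed
  qed
  have canes: "F.canes_at p = F'.canes_at p" if p: "p \<le> n" "\<not> F.is_root p" for p
  proof (rule power_bracket_unique)
    show "1 + t > 1" using F.t by simp
    have p': "\<not> F'.is_root p" "F'.root_pos p = F.root_pos p"
      using same p by auto
    show "0 < coord e x (F.root_pos p)"
      by (rule dec(1) [OF p(1)])
    show "(1 + t) ^ F.canes_at p * coord e x (F.root_pos p) < coord e x p"
      "coord e x p < (1 + t) ^ Suc (F.canes_at p) * coord e x (F.root_pos p)"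
      using dec(3,4) p by blast+
    show "(1 + t) ^ F'.canes_at p * coord e x (F.root_pos p) < coord e x p"
      "coord e x p < (1 + t) ^ Suc (F'.canes_at p) * coord e x (F.root_pos p)"
      using dec'(3) [OF p(1) p'(1)] dec'(4) [OF p(1) p'(1)] p'(2) by simp_all
  qed
  \<comment> \<open>The values agree position by position before the labels at these positions are
    known to agree.\<close>
  have c: "F.c x (F.node p) = F'.c x (F'.node p)" if p: "p \<le> n" for p
    unfolding F.c_node [OF p] F'.c_node [OF p] using same [OF p] canes [OF p] by simp
  have node: "F.node p = F'.node p" if p: "p \<le> n" for p
  proof -
    have "{q. q \<le> n \<and> F.c x (F.node q) < F.c x (F.node p)}
        = {q. q \<le> n \<and> F'.c x (F'.node q) < F'.c x (F'.node p)}"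
      using c p by auto
    then show ?thesis
      using F.node_rank [OF x p] F'.node_rank [OF x' p] by simp
  qed
  show ?thesis
  proof (rule forest_determined [OF F.F F'.F])
    show "nfs_order n F = nfs_order n F'"
      using node by (intro nth_equalityI) (auto simp: F.length_order F'.length_order)
    fix v assume "v \<in> {1..n+1}"
    then obtain p where p: "p \<le> n" "v = F.node p"
      using F.node_exists by blast
    show "root_of F v = v \<longleftrightarrow> root_of F' v = v"
      using same [OF p(1)] node [OF p(1)] p(2) by (simp add: F.is_root_def F'.is_root_def)
    show "cane_paths_from F v = cane_paths_from F' v" if "root_of F v \<noteq> v"
      using canes [OF p(1)] node [OF p(1)] p(2) that
      by (simp add: F.is_root_def F.canes_at_def F'.canes_at_def)
  qed
qed

text \<open>In the coordinates \<open>x\<^sub>i / (1 + t) ^ i\<close>, listed in reverse, the polytope is an ordered simplex.\<close>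

lemma gayley_polytope_simplex:
  fixes e :: "nat \<Rightarrow> 'n::finite"
  assumes n: "n \<ge> 1" and t: "t > 0" and e: "bij_betw e {1..n} (UNIV :: 'n set)"
  shows "int n simplex gayley_polytope n e t"
    and "fact n * measure lebesgue (gayley_polytope n e t) = (1 + t) ^ ((n + 1) choose 2)"
proof -
  define f where "f = inv_into {1..n} e"
  have fe: "f (e p) = p" if "p \<in> {1..n}" for p
    unfolding f_def using e that by (simp add: bij_betw_def)
  define L where "L = (\<lambda>x::real^'n. \<chi> i. (1 / (1 + t) ^ f i) * x $ i)"
  define e' where "e' = e \<circ> (\<lambda>k. n + 1 - k)"
  have "bij_betw (\<lambda>k. n + 1 - k) {1..n} {1..n}"
    by (rule bij_betw_byWitness [where f' = "\<lambda>k. n + 1 - k"]) auto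
  then have e': "bij_betw e' {1..n} UNIV"
    unfolding e'_def by (rule bij_betw_trans [OF _ e])
  have lin: "linear L"
    by (rule linearI) (auto simp: L_def vec_eq_iff algebra_simps add_divide_distrib)
  have "det (matrix L) = (\<Prod>i\<in>UNIV. 1 / (1 + t) ^ f i)"
    by (subst det_diagonal) (auto simp: matrix_def L_def axis_def)
  also have "\<dots> = (\<Prod>p\<in>{1..n}. 1 / (1 + t) ^ f (e p))"
    using prod.reindex_bij_betw [OF e, of "\<lambda>i. 1 / (1 + t) ^ f i"] by simp
  also have "\<dots> = (\<Prod>p\<in>{1..n}. 1 / (1 + t) ^ p)"
    by (rule prod.cong) (simp_all add: fe)
  also have "\<dots> = 1 / (1 + t) ^ (\<Sum>p\<in>{1..n}. p)"
    by (simp add: prod_dividef power_sum)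
  also have "(\<Sum>p\<in>{1..n}. p) = (n + 1) choose 2"
    using Sum_Icc_nat [of 1 n] by (simp add: choose_two)
  finally have det: "det (matrix L) = 1 / (1 + t) ^ ((n + 1) choose 2)" .
  have det0: "det (matrix L) \<noteq> 0"
    using t by (simp add: det)
  define y where "y = (\<lambda>x k. (L x + 0) $ e' k)"
  have y: "y x k = coord e x (n + 1 - k) / (1 + t) ^ (n + 1 - k)" if "k \<in> {1..n}" for x k
  proof -
    have "n + 1 - k \<in> {1..n}" "n + 1 - k \<noteq> 0" using that by auto
    then show ?thesis
      using fe by (simp add: y_def L_def e'_def coord_def)
  qed
  have step: "y x k \<le> y x (k + 1) \<longleftrightarrow> coord e x (n + 1 - k) \<le> (1 + t) * coord e x (n - k)"
    if "k \<in> {1..<n}" for x k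
  proof -
    have "n + 1 - k = Suc (n - k)" using that by auto
    then show ?thesis
      using that t divide_power_Suc_le_iff [of "1 + t"] by (simp add: y del: power_Suc)
  qed
  have steps: "(\<forall>k\<in>{1..<n}. y x k \<le> y x (k + 1)) \<longleftrightarrow>
      (\<forall>i\<in>{2..n}. coord e x i \<le> (1 + t) * coord e x (i - 1))" for x
  proof -
    have "{2..n} = (\<lambda>k. n + 1 - k) ` {1..<n}"
    proof (intro subset_antisym subsetI)
      fix i assume "i \<in> {2..n}"
      then show "i \<in> (\<lambda>k. n + 1 - k) ` {1..<n}"
        by (intro image_eqI [of _ _ "n + 1 - i"]) auto
    qed auto
    then show ?thesis
      using step by simp
  qed
  have G: "gayley_polytope n e t = {x. 0 \<le> y x 1 \<and> (\<forall>k\<in>{1..<n}. y x k \<le> y x (k+1)) \<and> y x n \<le> 1}"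
  proof -
    have ends: "0 \<le> y x 1 \<longleftrightarrow> 0 \<le> coord e x n" "y x n \<le> 1 \<longleftrightarrow> coord e x 1 \<le> 1 + t" for x
      using y [of 1 x] y [of n x] n t by (simp_all add: pos_le_divide_eq)
    \<comment> \<open>The chain bounds only the last coordinate below by 0; nonnegativity spreads
      from there to the earlier ones.\<close>
    have nonneg: "0 \<le> coord e x i"
      if "0 \<le> coord e x n" "\<forall>i\<in>{2..n}. coord e x i \<le> (1 + t) * coord e x (i - 1)" "1 \<le> i" "i \<le> n" for x i
      using that(4,3)
    proof (induction rule: inc_induct)
      case base
      show ?case by (rule that(1))
    next
      case (step i)
      have "0 \<le> coord e x (Suc i)" using step by simp
      also have "\<dots> \<le> (1 + t) * coord e x i"
        using that(2) [THEN bspec, of "Suc i"] step by simp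
      finally show ?case
        using t by (simp add: zero_le_mult_iff)
    qed
    show ?thesis
    proof (intro subset_antisym subsetI)
      fix x assume "x \<in> gayley_polytope n e t"
      then have x: "0 \<le> coord e x 1" "coord e x 1 \<le> 1 + t"
        "\<forall>i\<in>{2..n}. 0 \<le> coord e x i \<and> coord e x i \<le> (1 + t) * coord e x (i-1)"
        by (auto simp: gayley_polytope_def)
      moreover have "0 \<le> coord e x n"
        using x n by (cases "n = 1") auto
      ultimately show "x \<in> {x. 0 \<le> y x 1 \<and> (\<forall>k\<in>{1..<n}. y x k \<le> y x (k+1)) \<and> y x n \<le> 1}"
        unfolding mem_Collect_eq steps ends by simp
    next
      fix x assume "x \<in> {x. 0 \<le> y x 1 \<and> (\<forall>k\<in>{1..<n}. y x k \<le> y x (k+1)) \<and> y x n \<le> 1}"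
      then have x: "0 \<le> coord e x n" "\<forall>i\<in>{2..n}. coord e x i \<le> (1 + t) * coord e x (i - 1)"
          "coord e x 1 \<le> 1 + t"
        unfolding mem_Collect_eq steps ends by auto
      then show "x \<in> gayley_polytope n e t"
        using nonneg [OF x(1,2)] n by (auto simp: gayley_polytope_def)
    qed
  qed
  note * = ordered_simplex [OF lin det0 n e' zero_less_one, of 0]
  show "int n simplex gayley_polytope n e t"
    using *(1) unfolding G y_def .
  show "fact n * measure lebesgue (gayley_polytope n e t) = (1 + t) ^ ((n + 1) choose 2)"
    using *(2) t unfolding G y_def det by simp
qed

section \<open>Summing over all graphs, and covering by measure\<close>

lemma sum_labeled_graphs:
  fixes t :: real
  shows "(\<Sum>G\<in>labeled_graphs n. t ^ card G) = (1 + t) ^ ((n + 1) choose 2)"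
proof -
  have "{{u, v} | u v. u \<in> {1..n+1} \<and> v \<in> {1..n+1} \<and> u \<noteq> v} = {K. K \<subseteq> {1..n+1} \<and> card K = 2}"
    unfolding card_2_iff by blast
  moreover have "finite {K. K \<subseteq> {1..n+1} \<and> card K = 2}"
    by (rule finite_subset [of _ "Pow {1..n+1}"]) auto
  moreover have "card {K. K \<subseteq> {1..n+1} \<and> card K = 2} = (n + 1) choose 2"
    using n_subsets [of "{1..n+1}" 2] by simp
  ultimately show ?thesis
    unfolding labeled_graphs_def by (simp only: sum_Pow_power_card)
qed

lemma finite_labeled_graphs: "finite (labeled_graphs n)"
proof -
  have "labeled_graphs n \<subseteq> Pow (Pow {1..n+1})"
    by (auto simp: labeled_graphs_def)
  then show ?thesis by (rule finite_subset) simp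
qed

lemma search_forest_in: "G \<in> labeled_graphs n \<Longrightarrow> \<Phi> n G \<in> labeled_forests n"
proof -
  assume "G \<in> labeled_graphs n"
  then interpret labeled_graph n G by unfold_locales
  show ?thesis by (rule forest.in_labeled_forests)
qed

text \<open>A common point is not interior to both sets, so it lies on one of the frontiers, and the
  frontier of a convex set is negligible.\<close>

lemma negligible_convex_Int:
  fixes S T :: "'a::euclidean_space set"
  assumes "convex S" "convex T" "interior S \<inter> interior T = {}"
  shows "negligible (S \<inter> T)"
proof (rule negligible_subset)
  show "negligible (frontier S \<union> frontier T)"
    using assms by (intro negligible_Un negligible_convex_frontier)
  show "S \<inter> T \<subseteq> frontier S \<union> frontier T"
    using assms(3) closure_subset [of S] closure_subset [of T] by (auto simp: frontier_def)
qed

text \<open>The part of the interior of \<open>S\<close> outside \<open>T\<close> is open and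
  negligible, hence empty. Positive measure gives \<open>S\<close> interior points, and then a
  convex set lies in the closure of its interior.\<close>

lemma closed_full_measure_eq:
  fixes S T :: "'a::euclidean_space set"
  assumes "convex S" "S \<in> lmeasurable" "measure lebesgue S > 0" "closed T" "T \<in> lmeasurable"
    and "T \<subseteq> S" "measure lebesgue T = measure lebesgue S"
  shows "T = S"
proof -
  have "measure lebesgue (S - T) = measure lebesgue S - measure lebesgue T"
    using assms by (intro measurable_measure_Diff) auto
  then have "negligible (S - T)"
    using assms by (simp add: negligible_iff_measure fmeasurable.Diff)
  then have "negligible (interior S - T)"
    by (rule negligible_subset) (use interior_subset in auto)
  moreover have "open (interior S - T)"
    using assms(4) by (intro open_Diff) auto
  ultimately have "interior S - T = {}"
    using open_not_negligible by blast
  then have "closure (interior S) \<subseteq> T"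
    using assms(4) by (intro closure_minimal) auto
  moreover have "interior S \<noteq> {}"
    using assms(1,3) negligible_convex_interior [OF assms(1)] by (auto simp: negligible_iff_measure)
  then have "closure (interior S) = closure S"
    by (rule convex_closure_interior [OF assms(1)])
  ultimately show ?thesis
    using assms(6) closure_subset [of S] by blast
qed

theorem theorem6p3:
  fixes n :: nat and t :: real and e :: "nat \<Rightarrow> 'n::finite"
  assumes "n \<ge> 1" and "t > 0" and "bij_betw e {1..n} (UNIV :: 'n set)"
  shows
    "(\<forall>F \<in> labeled_forests n.
        int n simplex forest_simplex n e t F \<and>
        fact n * measure lebesgue (forest_simplex n e t F)
          = (\<Sum>G \<in> {G \<in> labeled_graphs n. \<Phi> n G = F}. t ^ card G) \<and>
        (\<Sum>G \<in> {G \<in> labeled_graphs n. \<Phi> n G = F}. t ^ card G)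
          = t ^ card F * (1 + t) ^ \<alpha> F) \<and>
     inj_on (forest_simplex n e t) (labeled_forests n) \<and>
     triangulation_of (forest_simplex n e t ` labeled_forests n) (gayley_polytope n e t) \<and>
     fact n * measure lebesgue (gayley_polytope n e t)
       = (\<Sum>G \<in> labeled_graphs n. t ^ card G) \<and>
     (\<Sum>G \<in> labeled_graphs n. t ^ card G) = (1 + t) ^ ((n + 1) choose 2)"
proof -
  let ?S = "forest_simplex n e t" and ?P = "gayley_polytope n e t" and ?\<F> = "labeled_forests n"
  have loc: "forest_polytope n F t e" if "F \<in> ?\<F>" for F
    by (intro forest_polytope.intro labeled_forest.intro forest_polytope_axioms.intro that assms)
  have simplex: "int n simplex ?S F" if "F \<in> ?\<F>" for F
    using forest_polytope.forest_simplex_simplex [OF loc [OF that]] .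
  have fiber: "(\<Sum>G \<in> {G \<in> labeled_graphs n. \<Phi> n G = F}. t ^ card G) = t ^ card F * (1 + t) ^ \<alpha> F"
    if "F \<in> ?\<F>" for F
    using labeled_forest.sum_fiber [OF labeled_forest.intro [OF that]] .
  have volume: "fact n * measure lebesgue (?S F)
      = (\<Sum>G \<in> {G \<in> labeled_graphs n. \<Phi> n G = F}. t ^ card G)" if "F \<in> ?\<F>" for F
    using forest_polytope.forest_simplex_volume [OF loc [OF that]] fiber [OF that] by simp
  have volume_P: "fact n * measure lebesgue ?P = (\<Sum>G \<in> labeled_graphs n. t ^ card G)"
    using gayley_polytope_simplex(2) [OF assms] by (simp add: sum_labeled_graphs)
  have meet: "F = F'" if "F \<in> ?\<F>" "F' \<in> ?\<F>" "interior (?S F) \<inter> interior (?S F') \<noteq> {}" for F F'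
    using that forest_eq_if_interiors_meet [OF loc loc] by blast
  have compact: "compact (?S F)" "convex (?S F)" if "F \<in> ?\<F>" for F
    using simplex_imp_polytope [OF simplex [OF that]] by (auto simp: polytope_imp_compact polytope_imp_convex)
  have poly_P: "polytope ?P"
    using gayley_polytope_simplex(1) [OF assms] simplex_imp_polytope by blast
  have fin: "finite ?\<F>"
    by (rule finite_subset [OF _ finite_labeled_graphs [of n]]) (auto simp: labeled_forests_def)
  have nonempty: "interior (?S F) \<noteq> {}" if "F \<in> ?\<F>" for F
  proof
    assume "interior (?S F) = {}"
    then have "negligible (?S F)"
      using negligible_convex_interior [OF compact(2) [OF that]] by simp
    then have "measure lebesgue (?S F) = 0"
      by (rule negligible_imp_measure0)
    then have "t ^ card F * (1 + t) ^ \<alpha> F = 0"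
      using volume [OF that] fiber [OF that] by simp
    then show False
      using \<open>t > 0\<close> by simp
  qed
  have "fact n * measure lebesgue (\<Union>F\<in>?\<F>. ?S F) = fact n * (\<Sum>F\<in>?\<F>. measure lebesgue (?S F))"
  proof (subst measure_negligible_finite_Union_image)
    show "pairwise (\<lambda>F F'. negligible (?S F \<inter> ?S F')) ?\<F>"
    proof (rule pairwiseI)
      fix F F' assume "F \<in> ?\<F>" "F' \<in> ?\<F>" "F \<noteq> F'"
      then show "negligible (?S F \<inter> ?S F')"
        using compact(2) meet by (intro negligible_convex_Int) blast+
    qed
  qed (use fin compact in \<open>auto intro: lmeasurable_compact\<close>)
  also have "\<dots> = (\<Sum>F\<in>?\<F>. \<Sum>G \<in> {G \<in> labeled_graphs n. \<Phi> n G = F}. t ^ card G)"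
    by (simp add: sum_distrib_left volume)
  \<comment> \<open>Every labeled graph lies in exactly one fiber, since its search forest is a
    labeled forest.\<close>
  also have "\<dots> = (\<Sum>G \<in> labeled_graphs n. t ^ card G)"
    using search_forest_in by (intro sum.group finite_labeled_graphs fin) auto
  finally have "fact n * measure lebesgue (\<Union>F\<in>?\<F>. ?S F) = fact n * measure lebesgue ?P"
    using volume_P by simp
  then have measure_eq: "measure lebesgue (\<Union>F\<in>?\<F>. ?S F) = measure lebesgue ?P"
    by simp
  have compact_U: "compact (\<Union>F\<in>?\<F>. ?S F)"
    using fin compact by (intro compact_UN) auto
  have "(\<Union>F\<in>?\<F>. ?S F) = ?P"
  proof (rule closed_full_measure_eq)
    show "convex ?P" "?P \<in> lmeasurable"
      using poly_P by (auto simp: polytope_imp_convex polytope_imp_compact lmeasurable_compact)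
    have "fact n * measure lebesgue ?P > 0"
      unfolding gayley_polytope_simplex(2) [OF assms] using \<open>t > 0\<close> by simp
    then show "measure lebesgue ?P > 0"
      by (simp add: zero_less_mult_iff)
    show "closed (\<Union>F\<in>?\<F>. ?S F)" "(\<Union>F\<in>?\<F>. ?S F) \<in> lmeasurable"
      using compact_U by (auto simp: compact_imp_closed lmeasurable_compact)
    show "(\<Union>F\<in>?\<F>. ?S F) \<subseteq> ?P"
      using forest_polytope.forest_simplex_subset [OF loc] by blast
  qed (rule measure_eq)
  moreover have "CARD('n) = n"
    using bij_betw_same_card [OF assms(3)] by simp
  moreover have "pairwise (\<lambda>S S'. interior S \<inter> interior S' = {}) (?S ` ?\<F>)"
    using meet by (auto simp: pairwise_def)
  ultimately have "triangulation_of (?S ` ?\<F>) ?P"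
    unfolding triangulation_of_def using poly_P simplex by simp
  \<comment> \<open>The triangulation is a set of simplices, in which equal simplices of different
    forests would coincide unnoticed. Nonempty interiors exclude this.\<close>
  moreover have "inj_on ?S ?\<F>"
  proof (rule inj_onI)
    fix F F' assume "F \<in> ?\<F>" "F' \<in> ?\<F>" "?S F = ?S F'"
    then show "F = F'"
      using meet [of F F'] nonempty [of F] by simp
  qed
  ultimately show ?thesis
    using simplex volume fiber volume_P sum_labeled_graphs by blast
qed

end
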